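(* There are absolute constants $c,C>0$ such that the following holds. Let $A$ be a finite subset of an abelian group with $|A|\ge 2$, and define $K$ by $\mathsf{E}_{3/2}(A)=|A|^{5/2}/K^{1/2}$. Then there exists a set $B\subseteq A$ such that $$|B|\ge c\,|A|/K^{2}\qquad\text{and}\qquad \dim(B)\le C\,K^{3/4}\log|A|.$$
   Context: For a finite subset $A$ of an abelian group $G$, $(A\circ A)(x)=|\{(a,a')\in A^2 : a'-a=x\}|$ and $\mathsf{E}_{3/2}(A)=\sum_{x\in G}(A\circ A)(x)^{3/2}$. All logarithms are to base $2$. A finite subset $\Lambda$ of an abelian group is dissociated if $\sum_{\lambda\in\Lambda}\varepsilon_\lambda\lambda=0$ with all $\varepsilon_\lambda\in\{-1,0,1\}$ implies $\varepsilon_\lambda=0$ for all $\lambda$ (the empty set is dissociated). For a finite set $B$, $\dim(B)$ is the maximal cardinality of a dissociated subset of $B$. *)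

theory Defs
  imports Complex_Main "HOL-Algebra.Algebra"
begin

text \<open>
  Abelian groups are HOL-Algebra's commutative groups, hence written multiplicatively:
  a difference \<open>a' - a\<close> reads \<open>a' \<otimes> inv a\<close>, and a sum of terms
  \<open>\<epsilon>(x) x\<close> reads as a finite product of powers.
\<close>

definition autocorr :: "('a, 'm) monoid_scheme \<Rightarrow> 'a set \<Rightarrow> 'a \<Rightarrow> nat" where
  "autocorr G A x = card {(a, a'). a \<in> A \<and> a' \<in> A \<and> a' \<otimes>\<^bsub>G\<^esub> inv\<^bsub>G\<^esub> a = x}"

text \<open>
  The carrier may be infinite, where \<^const>\<open>sum\<close> would return 0; so we sum over the
  support of the autocorrelation. The omitted terms are \<open>0 powr (3/2) = 0\<close>.
\<close>

definition energy_3_2 :: "('a, 'm) monoid_scheme \<Rightarrow> 'a set \<Rightarrow> real" where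
  "energy_3_2 G A =
     (\<Sum>x \<in> {x \<in> carrier G. autocorr G A x \<noteq> 0}. real (autocorr G A x) powr (3/2))"

definition dissociated :: "('a, 'm) monoid_scheme \<Rightarrow> 'a set \<Rightarrow> bool" where
  "dissociated G \<Lambda> \<longleftrightarrow>
     finite \<Lambda> \<and> \<Lambda> \<subseteq> carrier G \<and>
     (\<forall>\<epsilon> :: 'a \<Rightarrow> int.
        (\<forall>x\<in>\<Lambda>. \<epsilon> x \<in> {-1, 0, 1}) \<and> (\<Otimes>\<^bsub>G\<^esub>x\<in>\<Lambda>. x [^]\<^bsub>G\<^esub> \<epsilon> x) = \<one>\<^bsub>G\<^esub> \<longrightarrow>
        (\<forall>x\<in>\<Lambda>. \<epsilon> x = 0))"

definition additive_dim :: "('a, 'm) monoid_scheme \<Rightarrow> 'a set \<Rightarrow> nat" where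
  "additive_dim G B = Max (card ` {\<Lambda>. \<Lambda> \<subseteq> B \<and> dissociated G \<Lambda>})"

text \<open>
  The number \<open>K\<close> is positive and determined by \<open>A\<close>; \<open>0 < K\<close> is stated explicitly only
  because \<open>K powr (1/2)\<close> is a genuine square root just for such \<open>K\<close>.
\<close>

definition large_low_dim_subsets :: "real \<Rightarrow> real \<Rightarrow> ('a, 'm) monoid_scheme \<Rightarrow> bool" where
  "large_low_dim_subsets c C G \<longleftrightarrow>
     (\<forall>A K. finite A \<and> A \<subseteq> carrier G \<and> card A \<ge> 2 \<and> 0 < K \<and>
        energy_3_2 G A = real (card A) powr (5/2) / K powr (1/2) \<longrightarrow>
        (\<exists>B\<subseteq>A. real (card B) \<ge> c * real (card A) / K\<^sup>2 \<and>
               real (additive_dim G B) \<le> C * K powr (3/4) * log 2 (real (card A))))"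

text \<open>
  Absolute constants: HOL cannot quantify over types below \<open>\<exists>c C\<close>, and the plain
  statement \<open>\<exists>c C. \<forall>G :: 'a monoid. ...\<close> would let the constants depend on the type
  \<open>'a\<close>. Therefore a theorem claiming absolute constants for \<open>P c C\<close> has two parts: some
  \<open>c, C\<close> work for all groups carried by natural numbers, and any such \<open>c, C\<close> also work
  for all groups over an arbitrary type \<open>'a\<close>. Together they say that one fixed pair,
  chosen without reference to \<open>'a\<close>, serves every abelian group. The type \<open>nat\<close>
  suffices as reference because a finite set generates a countable subgroup.
\<close>

end

theory Submission
  imports Defs "HOL-Analysis.L2_Norm" "HOL-Library.Countable_Set"
begin

text \<open>
  If the conclusion failed, every subset of \<open>A\<close> with at least \<open>\<sigma> = |A| / (512 K\<^sup>2)\<close> elements would contain a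
  dissociated set of size \<open>k\<close>, slightly above \<open>4096 K\<^bsup>3/4\<^esup> log |A|\<close>. Convolution with a dissociated set \<open>L\<close> has
  norm \<open>O(sqrt (|L| log |A|))\<close> on functions with small support (a form of Rudin's inequality, proved by
  counting solutions of signed linear equations in \<open>L\<close>), so splitting greedily, convolution with any subset
  \<open>S\<close> of \<open>A\<close> has norm at most \<open>|S| K\<^bsup>-3/8\<^esup> / 4\<close> up to a remainder of at most \<open>\<sigma>\<close> elements of \<open>S\<close>.

  Write \<open>a\<^sub>s\<close> for the autocorrelation of \<open>A\<close> at \<open>s\<close>. Differences with \<open>a\<^sub>s < |A| / (16 K)\<close> carry at most a
  quarter of the energy. If those with \<open>a\<^sub>s \<ge> |A| / K\<^bsup>1/2\<^esup>\<close> carry a quarter, then \<open>\<Sum> a\<^sub>s\<^sup>2\<close> is at least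
  \<open>|A|\<^sup>3 K\<^bsup>-3/4\<^esup> / 4\<close>, contradicting the norm bound for \<open>A\<close>. Otherwise let \<open>f = a\<^bsup>1/4\<^esup>\<close> on the middle range \<open>Q\<close>; there
  \<open>\<Sum> a f\<close> is at least \<open>|A|\<^bsup>9/4\<^esup> K\<^bsup>-3/8\<^esup> / 2\<close>. By Cauchy-Schwarz its square is at most \<open>|A|\<close> times the sum
  of \<open>f(x - z) f(y - z)\<close> over triples in \<open>A\<close>. Grouping the triples by \<open>s = x - y\<close>, the norm bound applies
  to the slices \<open>A \<inter> (A + s)\<close>, and a second time to \<open>A\<close>; the remainders are harmless because \<open>\<sigma>\<close> has the factor \<open>K\<^bsup>-2\<^esup>\<close>.
\<close>

subsection \<open>Powers of symmetric kernels\<close>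

lemma sum_mult_le_sqrt_mult_sqrt:
  fixes f g :: "'b \<Rightarrow> real"
  shows "(\<Sum>i\<in>A. f i * g i) \<le> sqrt (\<Sum>i\<in>A. (f i)\<^sup>2) * sqrt (\<Sum>i\<in>A. (g i)\<^sup>2)"
proof -
  have "(\<Sum>i\<in>A. f i * g i) \<le> (\<Sum>i\<in>A. \<bar>f i\<bar> * \<bar>g i\<bar>)"
    by (intro sum_mono) (metis abs_ge_self abs_mult)
  also have "\<dots> \<le> L2_set f A * L2_set g A"
    by (rule L2_set_mult_ineq)
  finally show ?thesis
    by (simp add: L2_set_def)
qed

lemma sum_mult_power2_le:
  fixes f g :: "'b \<Rightarrow> real"
  shows "(\<Sum>i\<in>A. f i * g i)\<^sup>2 \<le> (\<Sum>i\<in>A. (f i)\<^sup>2) * (\<Sum>i\<in>A. (g i)\<^sup>2)"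
proof -
  have "\<bar>\<Sum>i\<in>A. f i * g i\<bar> \<le> (\<Sum>i\<in>A. \<bar>f i\<bar> * \<bar>g i\<bar>)"
    by (simp add: abs_mult[symmetric] sum_abs)
  also have "\<dots> \<le> L2_set f A * L2_set g A"
    by (rule L2_set_mult_ineq)
  finally have "\<bar>\<Sum>i\<in>A. f i * g i\<bar>\<^sup>2 \<le> (L2_set f A * L2_set g A)\<^sup>2"
    by (rule power_mono) simp
  also have "\<dots> = (\<Sum>i\<in>A. (f i)\<^sup>2) * (\<Sum>i\<in>A. (g i)\<^sup>2)"
    by (simp add: L2_set_def power_mult_distrib sum_nonneg)
  finally show ?thesis by simp
qed

definition kernel_op :: "'b set \<Rightarrow> ('b \<Rightarrow> 'b \<Rightarrow> real) \<Rightarrow> ('b \<Rightarrow> real) \<Rightarrow> 'b \<Rightarrow> real" where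
  "kernel_op Y p g y = (\<Sum>z\<in>Y. p y z * g z)"

lemma kernel_op_funpow_symmetric:
  assumes "\<And>y z. p y z = p z y"
  shows "(\<Sum>y\<in>Y. (kernel_op Y p ^^ n) g y * h y) = (\<Sum>y\<in>Y. g y * (kernel_op Y p ^^ n) h y)"
proof (induction n arbitrary: g h)
  case (Suc n)
  have 1: "(\<Sum>y\<in>Y. kernel_op Y p g y * h y) = (\<Sum>y\<in>Y. g y * kernel_op Y p h y)" for g h
    unfolding kernel_op_def sum_distrib_left sum_distrib_right
    by (subst sum.swap) (simp add: assms mult_ac)
  have "(\<Sum>y\<in>Y. (kernel_op Y p ^^ Suc n) g y * h y)
      = (\<Sum>y\<in>Y. (kernel_op Y p ^^ n) g y * kernel_op Y p h y)"
    by (simp add: 1)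
  also have "\<dots> = (\<Sum>y\<in>Y. g y * (kernel_op Y p ^^ n) (kernel_op Y p h) y)"
    by (rule Suc.IH)
  finally show ?case
    by (simp add: funpow_swap1)
qed auto

text \<open>Iterated Cauchy-Schwarz: for \<open>T = kernel_op Y p\<close>, which is self-adjoint,
  <g, T^n g>^2 <= |g|^2 <T^n g, T^n g> = |g|^2 <g, T^(2n) g>, so each of the \<open>r\<close> rounds
  doubles the exponent. Nonnegativity of \<open>p\<close> and \<open>g\<close> permits squaring the
  induction hypothesis.\<close>

lemma kernel_op_quadratic_form_power:
  assumes sym: "\<And>y z. p y z = p z y" and p: "\<And>y z. p y z \<ge> 0" and g: "\<And>y. g y \<ge> 0"
  shows "(\<Sum>y\<in>Y. g y * kernel_op Y p g y) ^ 2 ^ r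
    \<le> (\<Sum>y\<in>Y. (g y)\<^sup>2) ^ (2 ^ r - 1) * (\<Sum>y\<in>Y. g y * (kernel_op Y p ^^ 2 ^ r) g y)"
proof (induction r)
  case (Suc r)
  let ?N = "\<Sum>y\<in>Y. (g y)\<^sup>2"
  let ?T = "\<lambda>n. (\<Sum>y\<in>Y. g y * (kernel_op Y p ^^ n) g y)"
  have N: "?N \<ge> 0" by (simp add: sum_nonneg)
  have "(?T (2 ^ r))\<^sup>2 \<le> ?N * (\<Sum>y\<in>Y. ((kernel_op Y p ^^ 2 ^ r) g y)\<^sup>2)"
    by (rule sum_mult_power2_le)
  also have "(\<Sum>y\<in>Y. ((kernel_op Y p ^^ 2 ^ r) g y)\<^sup>2) = ?T (2 ^ r + 2 ^ r)"
    unfolding power2_eq_square funpow_add comp_def by (rule kernel_op_funpow_symmetric[OF sym])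
  finally have dbl: "(?T (2 ^ r))\<^sup>2 \<le> ?N * ?T (2 ^ Suc r)"
    by (simp add: mult_2)
  have "(\<Sum>y\<in>Y. g y * kernel_op Y p g y) ^ 2 ^ Suc r
      = ((\<Sum>y\<in>Y. g y * kernel_op Y p g y) ^ 2 ^ r)\<^sup>2"
    by (simp add: power_mult[symmetric] mult.commute)
  also have "\<dots> \<le> (?N ^ (2 ^ r - 1) * ?T (2 ^ r))\<^sup>2"
    by (intro power_mono Suc.IH zero_le_power sum_nonneg mult_nonneg_nonneg g)
      (simp add: kernel_op_def p g sum_nonneg)
  also have "\<dots> = ?N ^ (2 * (2 ^ r - 1)) * (?T (2 ^ r))\<^sup>2"
    by (simp add: power_mult_distrib power_mult[symmetric] mult.commute)
  also have "\<dots> \<le> ?N ^ (2 * (2 ^ r - 1)) * (?N * ?T (2 ^ Suc r))"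
    by (intro mult_left_mono dbl zero_le_power N)
  also have "\<dots> = ?N ^ (2 * (2 ^ r - 1) + 1) * ?T (2 ^ Suc r)"
    by simp
  also have "2 * (2 ^ r - 1) + 1 = 2 ^ Suc r - (1::nat)"
  proof -
    have "(1::nat) \<le> 2 ^ r" by simp
    then show ?thesis unfolding power_Suc by linarith
  qed
  finally show ?case .
qed simp

subsection \<open>Signed products in dissociated sets\<close>

lemma sum_PiE_insert:
  assumes "i \<notin> I"
  shows "(\<Sum>t\<in>insert i I \<rightarrow>\<^sub>E L. \<phi> t) = (\<Sum>x\<in>L. \<Sum>t\<in>I \<rightarrow>\<^sub>E L. \<phi> (t(i := x)))"
proof -
  have "inj_on (\<lambda>(x, t). t(i := x)) (L \<times> (I \<rightarrow>\<^sub>E L))"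
    using inj_combinator[OF assms, of "\<lambda>_. L"] .
  then show ?thesis
    by (simp add: PiE_insert_eq sum.reindex sum.cartesian_product case_prod_unfold)
qed

context comm_group
begin

lemma dissociated_subset:
  assumes "dissociated G L" "L' \<subseteq> L"
  shows "dissociated G L'"
  unfolding dissociated_def
proof (intro conjI allI impI)
  show "finite L'" "L' \<subseteq> carrier G"
    using assms finite_subset unfolding dissociated_def by auto
  fix \<epsilon> :: "'a \<Rightarrow> int"
  assume \<epsilon>: "(\<forall>x\<in>L'. \<epsilon> x \<in> {-1, 0, 1}) \<and> (\<Otimes>x\<in>L'. x [^] \<epsilon> x) = \<one>"
  define \<delta> where "\<delta> x = (if x \<in> L' then \<epsilon> x else 0)" for x
  have prod: "(\<Otimes>x\<in>L. x [^] \<delta> x) = (\<Otimes>x\<in>L'. x [^] \<epsilon> x)"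
    using assms by (intro finprod_mono_neutral_cong_right) (auto simp: \<delta>_def dissociated_def)
  have "\<forall>x\<in>L. \<delta> x \<in> {-1, 0, 1}"
    using \<epsilon> by (simp add: \<delta>_def)
  then have "(\<forall>x\<in>L. \<delta> x \<in> {-1, 0, 1}) \<and> (\<Otimes>x\<in>L. x [^] \<delta> x) = \<one>"
    using conjunct2[OF \<epsilon>] unfolding prod by (rule conjI)
  then have zero: "\<forall>x\<in>L. \<delta> x = 0"
    using assms(1) unfolding dissociated_def by (elim conjE) (erule allE, erule (1) impE[OF _ conjI])
  show "\<forall>x\<in>L'. \<epsilon> x = 0"
  proof
    fix x assume "x \<in> L'"
    then show "\<epsilon> x = 0"
      using bspec[OF zero, of x] assms(2) by (auto simp: \<delta>_def)
  qed
qed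

text \<open>
  A set \<open>S\<close> prescribing which elements carry the sign \<open>1\<close> reduces signed products of distinct
  elements to subset products, where dissociativity applies.
\<close>

lemma dissociated_signed_image_eq:
  fixes \<epsilon> :: "'i \<Rightarrow> int"
  assumes L: "dissociated G L" and U: "finite U" and \<epsilon>: "\<And>u. u \<in> U \<Longrightarrow> \<epsilon> u \<in> {-1, 1}"
    and t: "t ` U \<subseteq> L" "inj_on t U" "\<And>u. u \<in> U \<Longrightarrow> t u \<in> S \<longleftrightarrow> \<epsilon> u = 1"
    and t': "t' ` U \<subseteq> L" "inj_on t' U" "\<And>u. u \<in> U \<Longrightarrow> t' u \<in> S \<longleftrightarrow> \<epsilon> u = 1"
    and eq: "(\<Otimes>u\<in>U. t u [^] \<epsilon> u) = (\<Otimes>u\<in>U. t' u [^] \<epsilon> u)"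
  shows "t ` U = t' ` U"
proof -
  have LG: "L \<subseteq> carrier G" "finite L"
    using L by (auto simp: dissociated_def)
  \<comment> \<open>\<open>e s\<close> moves the signs from positions to elements of
    \<open>L\<close>. Since \<open>S\<close> decides the sign of an element, \<open>e s\<close>
    depends only on the image of \<open>U\<close> under \<open>s\<close>.\<close>
  define e :: "('i \<Rightarrow> 'a) \<Rightarrow> 'a \<Rightarrow> int"
    where "e s x = (if x \<in> s ` U then (if x \<in> S then 1 else -1) else 0)" for s x
  have expand: "(\<Otimes>x\<in>L. x [^] e s x) = (\<Otimes>u\<in>U. s u [^] \<epsilon> u)"
    if s: "s ` U \<subseteq> L" "inj_on s U" "\<And>u. u \<in> U \<Longrightarrow> s u \<in> S \<longleftrightarrow> \<epsilon> u = 1" for s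
  proof -
    have "(\<Otimes>x\<in>L. x [^] e s x) = (\<Otimes>x\<in>s ` U. x [^] e s x)"
      using LG s(1) by (intro finprod_mono_neutral_cong_right) (auto simp: e_def)
    also have "\<dots> = (\<Otimes>u\<in>U. s u [^] e s (s u))"
      using LG s by (intro finprod_reindex) auto
    also have "\<dots> = (\<Otimes>u\<in>U. s u [^] \<epsilon> u)"
    proof (rule finprod_cong')
      show "s u [^] e s (s u) = s u [^] \<epsilon> u" if "u \<in> U" for u
        using that s(3)[OF that] \<epsilon>[OF that] by (auto simp: e_def)
    qed (use LG s in auto)
    finally show ?thesis .
  qed
  define P where "P = (\<Otimes>x\<in>L. x [^] (e t x - e t' x))"
  have closed: "P \<in> carrier G" "(\<Otimes>x\<in>L. x [^] e t' x) \<in> carrier G"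
    using LG unfolding P_def by (simp_all add: Pi_iff subsetD)
  have "P \<otimes> (\<Otimes>x\<in>L. x [^] e t' x) = (\<Otimes>x\<in>L. x [^] (e t x - e t' x) \<otimes> x [^] e t' x)"
    using LG unfolding P_def by (subst finprod_multf) auto
  also have "\<dots> = (\<Otimes>x\<in>L. x [^] e t x)"
    using LG by (intro finprod_cong') (auto simp: int_pow_mult[symmetric])
  also have "\<dots> = (\<Otimes>x\<in>L. x [^] e t' x)"
    using expand[OF t] expand[OF t'] eq by simp
  finally have "P = \<one>"
    using closed r_cancel_one by simp
  \<comment> \<open>An element of both images has the same sign in both, so the difference is never
    2 or -2.\<close>
  moreover have "\<forall>x\<in>L. e t x - e t' x \<in> {-1, 0, 1}"
    by (simp add: e_def)
  moreover have "(\<forall>x\<in>L. e t x - e t' x \<in> {-1, 0, 1}) \<and> P = \<one> \<longrightarrow> (\<forall>x\<in>L. e t x - e t' x = 0)"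
    using L unfolding dissociated_def P_def by (elim conjE) (erule allE)
  ultimately have "\<forall>x\<in>L. e t x - e t' x = 0"
    by blast
  then have eq: "e t x = e t' x" if "x \<in> L" for x
    using that by simp
  have e: "x \<in> s ` U \<longleftrightarrow> e s x \<noteq> 0" for s x
    by (simp add: e_def)
  show ?thesis
  proof (rule Set.set_eqI)
    show "x \<in> t ` U \<longleftrightarrow> x \<in> t' ` U" for x
    proof (cases "x \<in> L")
      case True
      then show ?thesis by (simp only: e eq)
    next
      case False
      then show ?thesis using t(1) t'(1) by blast
    qed
  qed
qed

text \<open>Double counting of pairs of a tuple \<open>t\<close> and a subset \<open>S\<close> of
  \<open>L\<close> that contains, among the values of \<open>t\<close>, exactly those with sign 1.
  For fixed \<open>S\<close> all such tuples have the same image, so there are at most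
  \<open>card U ^ card U\<close> of them; each \<open>t\<close> admits at least
  \<open>2 ^ (card L - card U)\<close> sets \<open>S\<close>.\<close>

lemma card_injective_signed_tuples_le:
  fixes \<epsilon> :: "'i \<Rightarrow> int"
  assumes L: "dissociated G L" and U: "finite U" and \<epsilon>: "\<And>u. u \<in> U \<Longrightarrow> \<epsilon> u \<in> {-1, 1}"
  shows "card {t \<in> U \<rightarrow>\<^sub>E L. inj_on t U \<and> (\<Otimes>u\<in>U. t u [^] \<epsilon> u) = x} \<le> 2 ^ card U * card U ^ card U"
    (is "card ?T \<le> _")
proof (cases "?T = {}")
  case False
  have fin: "finite L" "finite ?T"
    using L U by (auto simp: dissociated_def intro!: finite_PiE)
  define C where "C t S \<longleftrightarrow> (\<forall>u\<in>U. t u \<in> S \<longleftrightarrow> \<epsilon> u = 1)" for t and S :: "'a set"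
  have le: "card U \<le> card L"
    using False fin by (auto simp: PiE_iff intro!: card_inj_on_le)
  have few: "card {t \<in> ?T. C t S} \<le> card U ^ card U" for S
  proof (cases "{t \<in> ?T. C t S} = {}")
    case False
    then obtain t0 where t0: "t0 \<in> ?T" "C t0 S" by auto
    have "{t \<in> ?T. C t S} \<subseteq> U \<rightarrow>\<^sub>E t0 ` U"
    proof
      fix t assume t: "t \<in> {t \<in> ?T. C t S}"
      have "t ` U = t0 ` U"
        using t t0 by (intro dissociated_signed_image_eq[OF L U \<epsilon>, where S = S]) (auto simp: C_def)
      then show "t \<in> U \<rightarrow>\<^sub>E t0 ` U"
        using t by (auto simp: PiE_iff)
    qed
    then have "card {t \<in> ?T. C t S} \<le> card (U \<rightarrow>\<^sub>E t0 ` U)"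
      using U by (intro card_mono finite_PiE) auto
    also have "\<dots> = card U ^ card U"
      using t0(1) U by (simp add: card_PiE card_image)
    finally show ?thesis .
  next
    case True
    then show ?thesis by (simp only: card.empty)
  qed
  have many: "2 ^ (card L - card U) \<le> card {S \<in> Pow L. C t S}" if t: "t \<in> ?T" for t
  proof -
    \<comment> \<open>The values with sign 1 are forced into \<open>S\<close>; the elements of
      \<open>L\<close> outside the image of \<open>t\<close> are free.\<close>
    define V where "V = t ` {u \<in> U. \<epsilon> u = 1}"
    have "inj_on (\<lambda>S. S \<union> V) (Pow (L - t ` U))"
      by (rule inj_on_inverseI[where g = "\<lambda>S. S - V"]) (auto simp: V_def)
    moreover have "(\<lambda>S. S \<union> V) ` Pow (L - t ` U) \<subseteq> {S \<in> Pow L. C t S}"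
      using t unfolding V_def C_def by (auto simp: PiE_iff inj_on_def)
    ultimately have "card (Pow (L - t ` U)) \<le> card {S \<in> Pow L. C t S}"
      using fin by (intro card_inj_on_le) auto
    moreover have "card (L - t ` U) = card L - card U"
      using t U by (subst card_Diff_subset) (auto simp: card_image)
    ultimately show ?thesis
      using fin by (simp add: card_Pow)
  qed
  have "card ?T * 2 ^ (card L - card U) = (\<Sum>t\<in>?T. 2 ^ (card L - card U))"
    by simp
  also have "\<dots> \<le> (\<Sum>t\<in>?T. card {S \<in> Pow L. C t S})"
    by (intro sum_mono many)
  also have "\<dots> = (\<Sum>S\<in>Pow L. card {t \<in> ?T. C t S})"
    using fin by (intro sum_multicount_gen) auto
  also have "\<dots> \<le> (\<Sum>S\<in>Pow L. card U ^ card U)"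
    by (intro sum_mono few)
  also have "\<dots> = 2 ^ (card L - card U) * (2 ^ card U * card U ^ card U)"
    using fin le by (simp add: card_Pow power_add[symmetric] mult.assoc[symmetric])
  finally show ?thesis
    by simp
qed (simp only: card.empty)

section \<open>Signed tuples with repeated values\<close>

definition signed_tuples :: "'a set \<Rightarrow> ('i \<Rightarrow> int) \<Rightarrow> 'i set \<Rightarrow> 'i set \<Rightarrow> 'a \<Rightarrow> ('i \<Rightarrow> 'a) set" where
  "signed_tuples L \<epsilon> U I x = {t \<in> (U \<union> I) \<rightarrow>\<^sub>E L.
     inj_on t U \<and> (\<forall>u\<in>U. \<forall>i\<in>I. t u \<noteq> t i) \<and> (\<Otimes>i\<in>U \<union> I. t i [^] \<epsilon> i) = x}"

lemma finite_signed_tuples: "finite L \<Longrightarrow> finite U \<Longrightarrow> finite I \<Longrightarrow> finite (signed_tuples L \<epsilon> U I x)"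
  unfolding signed_tuples_def by (rule finite_subset[of _ "(U \<union> I) \<rightarrow>\<^sub>E L"]) (auto intro: finite_PiE)

text \<open>Forgetting the positions \<open>i\<close> and \<open>j\<close> is injective, as both
  values are known to be \<open>\<mu>\<close>. Their factors move into the target of the product, so
  the recursion needs counts for every target.\<close>

lemma card_signed_tuples_coincident_le:
  fixes \<epsilon> :: "'i \<Rightarrow> int"
  assumes L: "finite L" "L \<subseteq> carrier G" and fin: "finite U" "finite I" and disj: "U \<inter> I = {}"
    and i: "i \<in> I" "j \<in> I" "i \<noteq> j" and \<mu>: "\<mu> \<in> L"
  shows "card {t \<in> signed_tuples L \<epsilon> U I x. t i = \<mu> \<and> t j = \<mu>}
    \<le> card (signed_tuples L \<epsilon> U (I - {i, j}) (inv (\<mu> [^] \<epsilon> i \<otimes> \<mu> [^] \<epsilon> j) \<otimes> x))"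
    (is "card ?T \<le> card ?T'")
proof (rule card_inj_on_le)
  let ?R = "\<lambda>t. restrict t (U \<union> (I - {i, j}))"
  show "inj_on ?R ?T"
  proof (rule inj_onI)
    fix s t assume s: "s \<in> ?T" and t: "t \<in> ?T" and eq: "?R s = ?R t"
    show "s = t"
    proof (rule PiE_ext)
      show "s \<in> (U \<union> I) \<rightarrow>\<^sub>E L" "t \<in> (U \<union> I) \<rightarrow>\<^sub>E L"
        using s t by (auto simp: signed_tuples_def)
      show "s k = t k" if "k \<in> U \<union> I" for k
        using s t that fun_cong[OF eq, of k] by (auto simp: restrict_def split: if_splits)
    qed
  qed
  show "?R ` ?T \<subseteq> ?T'"
  proof clarify
    fix t assume t: "t \<in> signed_tuples L \<epsilon> U I x" and ti: "t j = t i" "\<mu> = t i"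
    let ?J = "U \<union> (I - {i, j})" and ?a = "t i [^] \<epsilon> i" and ?b = "t i [^] \<epsilon> j"
    let ?P = "\<Otimes>k\<in>?J. t k [^] \<epsilon> k"
    have tPi: "t \<in> (U \<union> I) \<rightarrow>\<^sub>E L" and tU: "inj_on t U" "\<forall>u\<in>U. \<forall>k\<in>I. t u \<noteq> t k"
      and tx: "(\<Otimes>k\<in>U \<union> I. t k [^] \<epsilon> k) = x"
      using t by (simp_all add: signed_tuples_def)
    have tL: "t k \<in> carrier G" if "k \<in> U \<union> I" for k
      using PiE_mem[OF tPi that] L by blast
    have closed: "?a \<in> carrier G" "?b \<in> carrier G" "?P \<in> carrier G"
      using tL i by (auto intro!: finprod_closed)
    have J: "U \<union> I = insert i (insert j ?J)" "i \<notin> insert j ?J" "j \<notin> ?J" "finite ?J"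
      using i disj fin by auto
    have "(\<Otimes>k\<in>U \<union> I. t k [^] \<epsilon> k) = ?a \<otimes> (\<Otimes>k\<in>insert j ?J. t k [^] \<epsilon> k)"
      unfolding J(1) by (rule finprod_insert) (use J tL i in auto)
    also have "(\<Otimes>k\<in>insert j ?J. t k [^] \<epsilon> k) = t j [^] \<epsilon> j \<otimes> ?P"
      by (rule finprod_insert) (use J tL i in auto)
    finally have "x = (?a \<otimes> ?b) \<otimes> ?P"
      using tx ti(1) closed by (simp add: m_assoc)
    then have "?P = inv (?a \<otimes> ?b) \<otimes> x"
      using closed m_assoc[of "inv (?a \<otimes> ?b)" "?a \<otimes> ?b" ?P] by simp
    moreover have "(\<Otimes>k\<in>?J. ?R t k [^] \<epsilon> k) = ?P"
      using tL by (intro finprod_cong') auto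
    moreover have "?R t \<in> ?J \<rightarrow>\<^sub>E L"
      using PiE_mem[OF tPi] by auto
    moreover have "inj_on (?R t) U"
      using tU(1) by (auto simp: inj_on_def)
    moreover have "\<forall>u\<in>U. \<forall>k\<in>I - {i, j}. ?R t u \<noteq> ?R t k"
      using tU(2) by simp
    ultimately show "?R t \<in> signed_tuples L \<epsilon> U (I - {i, j}) (inv (?a \<otimes> ?b) \<otimes> x)"
      unfolding signed_tuples_def by simp
  qed
  show "finite ?T'"
    using L fin by (intro finite_signed_tuples) auto
qed

text \<open>
  \<open>U\<close> collects the positions whose value occurs only once. A position of \<open>I\<close> either shares its value
  with another one, and both are removed, or it moves to \<open>U\<close>.
\<close>

lemma card_signed_tuples_le:
  fixes \<epsilon> :: "'i \<Rightarrow> int"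
  assumes L: "dissociated G L" and \<epsilon>: "\<And>i. \<epsilon> i \<in> {-1, 1}"
    and W: "W \<ge> 2 * real M" "W\<^sup>2 \<ge> 4 * real M * real (card L)"
    and "finite U" "finite I" "U \<inter> I = {}" "card U + card I \<le> M" "M > 0"
  shows "real (card (signed_tuples L \<epsilon> U I x)) \<le> W ^ (card U + card I) * 2 ^ card I"
  using assms(5-8)
proof (induction "card I" arbitrary: U I x rule: less_induct)
  case less
  note fin = \<open>finite U\<close> \<open>finite I\<close>
  have L': "finite L" "L \<subseteq> carrier G"
    using L by (auto simp: dissociated_def)
  have W0: "W > 0"
    using W(1) \<open>M > 0\<close> by linarith
  show ?case
  proof (cases "I = {}")
    case True
    have "card (signed_tuples L \<epsilon> U I x) \<le> 2 ^ card U * card U ^ card U"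
      using card_injective_signed_tuples_le[OF L fin(1) \<epsilon>, where x = x] True by (simp add: signed_tuples_def)
    then have "real (card (signed_tuples L \<epsilon> U I x)) \<le> real (2 ^ card U * card U ^ card U)"
      by (simp only: of_nat_le_iff)
    also have "\<dots> = (2 * real (card U)) ^ card U"
      by (simp add: power_mult_distrib)
    also have "\<dots> \<le> W ^ card U"
      using W(1) less.prems(4) by (intro power_mono) auto
    finally show ?thesis
      using True by simp
  next
    case False
    then obtain i where i: "i \<in> I" by auto
    define T where "T j \<mu> = {t \<in> signed_tuples L \<epsilon> U I x. t i = \<mu> \<and> t j = \<mu>}" for j \<mu>
    let ?J = "I - {i}" and ?m = "card U + card I" and ?c = "card I"
    let ?S = "signed_tuples L \<epsilon> (insert i U) ?J x"
    have "signed_tuples L \<epsilon> U I x \<subseteq> (\<Union>(j, \<mu>)\<in>?J \<times> L. T j \<mu>) \<union> ?S"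
    proof
      fix t assume t: "t \<in> signed_tuples L \<epsilon> U I x"
      have un: "insert i U \<union> ?J = U \<union> I"
        using i by auto
      show "t \<in> (\<Union>(j, \<mu>)\<in>?J \<times> L. T j \<mu>) \<union> ?S"
      proof (cases "\<exists>j\<in>?J. t j = t i")
        case True
        then show ?thesis
          using t i by (auto simp: T_def signed_tuples_def PiE_iff)
      next
        case False
        have tU: "inj_on t U" "\<And>u k. u \<in> U \<Longrightarrow> k \<in> I \<Longrightarrow> t u \<noteq> t k"
          using t by (auto simp: signed_tuples_def)
        have "inj_on t (insert i U)"
          using tU i by (force simp: inj_on_insert)
        moreover have "\<forall>u\<in>insert i U. \<forall>k\<in>?J. t u \<noteq> t k"
          using tU False by (metis Diff_iff insert_iff)
        ultimately have "t \<in> ?S"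
          using t unfolding signed_tuples_def un by simp
        then show ?thesis by blast
      qed
    qed
    then have "card (signed_tuples L \<epsilon> U I x) \<le> card ((\<Union>(j, \<mu>)\<in>?J \<times> L. T j \<mu>) \<union> ?S)"
      using L' fin by (intro card_mono) (auto simp: T_def intro!: finite_signed_tuples)
    also have "\<dots> \<le> card (\<Union>(j, \<mu>)\<in>?J \<times> L. T j \<mu>) + card ?S"
      by (rule card_Un_le)
    also have "card (\<Union>(j, \<mu>)\<in>?J \<times> L. T j \<mu>) \<le> (\<Sum>(j, \<mu>)\<in>?J \<times> L. card (T j \<mu>))"
      using card_UN_le[of "?J \<times> L" "\<lambda>(j, \<mu>). T j \<mu>"] L' fin by (simp add: case_prod_unfold)
    finally have "real (card (signed_tuples L \<epsilon> U I x))
        \<le> (\<Sum>(j, \<mu>)\<in>?J \<times> L. real (card (T j \<mu>))) + real (card ?S)"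
      by (simp add: case_prod_unfold flip: of_nat_sum)
    \<comment> \<open>Moving \<open>i\<close> to \<open>U\<close> keeps the number of positions and
      lowers \<open>card I\<close> by one: half of the claimed bound.\<close>
    also have "real (card ?S) \<le> W ^ ?m * 2 ^ (?c - 1)"
    proof -
      have pos: "?c > 0"
        using i fin by (auto simp: card_gt_0_iff)
      have J: "card ?J = ?c - 1"
        using i fin by simp
      have "i \<notin> U"
        using i less.prems(3) by blast
      then have "card (insert i U) = card U + 1"
        using fin by simp
      then have m: "card (insert i U) + card ?J = ?m"
        using J pos by simp
      have "real (card ?S) \<le> W ^ (card (insert i U) + card ?J) * 2 ^ card ?J"
        using less.prems i J pos m by (intro less.hyps) auto
      then show ?thesis
        by (simp only: m[unfolded J] J)
    qed
    \<comment> \<open>There are at most \<open>M * card L\<close>, hence at most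
      \<open>W\<^sup>2 / 4\<close>, coincidences \<open>(j, \<mu>)\<close>. With two positions
      fewer, the power of 2 gives another factor 1/4, and 1/16 + 1/2 stays below 1.\<close>
    also have "(\<Sum>(j, \<mu>)\<in>?J \<times> L. real (card (T j \<mu>))) \<le> W ^ ?m * 2 ^ ?c / 16"
    proof (cases "?c \<ge> 2")
      case False
      then have "card ?J = 0"
        using i fin by simp
      then have "?J = {}"
        using fin by simp
      then show ?thesis
        using W0 by (simp only:) simp
    next
      case True
      have "real (card (T j \<mu>)) \<le> W ^ (?m - 2) * 2 ^ (?c - 2)" if "j \<in> ?J" "\<mu> \<in> L" for j \<mu>
      proof -
        have c: "card (I - {i, j}) = ?c - 2"
          using that i fin by (subst card_Diff_subset) (auto simp: card_insert_if)
        have "card (T j \<mu>) \<le> card (signed_tuples L \<epsilon> U (I - {i, j}) (inv (\<mu> [^] \<epsilon> i \<otimes> \<mu> [^] \<epsilon> j) \<otimes> x))"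
          unfolding T_def using that i less.prems L'
          by (intro card_signed_tuples_coincident_le) auto
        then have "real (card (T j \<mu>)) \<le> real (card (signed_tuples L \<epsilon> U (I - {i, j}) (inv (\<mu> [^] \<epsilon> i \<otimes> \<mu> [^] \<epsilon> j) \<otimes> x)))"
          by simp
        also have "\<dots> \<le> W ^ (card U + (?c - 2)) * 2 ^ (?c - 2)"
          unfolding c[symmetric] using less.prems c True by (intro less.hyps) auto
        finally show ?thesis
          using True by simp
      qed
      then have "(\<Sum>(j, \<mu>)\<in>?J \<times> L. real (card (T j \<mu>))) \<le> (\<Sum>(j, \<mu>)\<in>?J \<times> L. W ^ (?m - 2) * 2 ^ (?c - 2))"
        by (intro sum_mono) auto
      also have "\<dots> = real (card ?J) * real (card L) * (W ^ (?m - 2) * 2 ^ (?c - 2))"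
        by (simp add: case_prod_unfold card_cartesian_product)
      also have "\<dots> \<le> real M * real (card L) * (W ^ (?m - 2) * 2 ^ (?c - 2))"
        using less.prems i fin W0 card_Diff1_le[of I i]
        by (intro mult_right_mono) (auto intro!: mult_nonneg_nonneg)
      also have "\<dots> \<le> (W\<^sup>2 / 4) * (W ^ (?m - 2) * 2 ^ (?c - 2))"
        using W W0 by (intro mult_right_mono) auto
      also have "\<dots> = W ^ (2 + (?m - 2)) * 2 ^ (2 + (?c - 2)) / 16"
        by (simp only: power_add) simp
      also have "2 + (?m - 2) = ?m"
        using True by simp
      also have "2 + (?c - 2) = ?c"
        using True by simp
      finally show ?thesis .
    qed
    also have "W ^ ?m * 2 ^ (?c - 1) = W ^ ?m * 2 ^ ?c / 2"
      using i fin by (cases ?c) auto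
    also have "W ^ ?m * 2 ^ ?c / 16 + W ^ ?m * 2 ^ ?c / 2 \<le> W ^ ?m * 2 ^ ?c"
      using W0 by simp
    finally show ?thesis by simp
  qed
qed

text \<open>The moment bound behind Rudin's inequality. All positions start in \<open>I\<close>,
  with \<open>M = 2 * n\<close> and the least \<open>W\<close> that meets the quadratic condition;
  the linear condition follows from \<open>2 * n <= card L\<close>. The result is
  \<open>(2 * W) ^ (2 * n)\<close>.\<close>

lemma card_signed_product_tuples_le:
  fixes \<epsilon> :: "nat \<Rightarrow> int"
  assumes L: "dissociated G L" and \<epsilon>: "\<And>i. \<epsilon> i \<in> {-1, 1}" and n: "0 < n" "2 * n \<le> card L"
  shows "real (card {t \<in> {..<2 * n} \<rightarrow>\<^sub>E L. (\<Otimes>i\<in>{..<2 * n}. t i [^] \<epsilon> i) = x})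
    \<le> (32 * real n * real (card L)) ^ n"
proof -
  define W where "W = sqrt (4 * real (2 * n) * real (card L))"
  have W2: "W\<^sup>2 = 4 * real (2 * n) * real (card L)"
    by (simp add: W_def)
  have "(2 * real (2 * n))\<^sup>2 \<le> 4 * real (2 * n) * real (card L)"
    using n by (simp add: power2_eq_square)
  then have W: "2 * real (2 * n) \<le> W"
    unfolding W_def by (rule real_le_rsqrt)
  have "real (card (signed_tuples L \<epsilon> {} {..<2 * n} x)) \<le> W ^ (card ({} :: nat set) + card {..<2 * n}) * 2 ^ card {..<2 * n}"
    using W W2 n by (intro card_signed_tuples_le[OF L \<epsilon>, where M = "2 * n"]) auto
  also have "\<dots> = (W\<^sup>2 * 4) ^ n"
    by (simp add: power_mult power_mult_distrib)
  also have "W\<^sup>2 * 4 = 32 * real n * real (card L)"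
    by (simp add: W2)
  finally show ?thesis
    by (simp add: signed_tuples_def)
qed

end

subsection \<open>Convolution with dissociated sets\<close>

text \<open>\<open>walk_kernel G L y z\<close> counts the ways to reach \<open>z\<close> from \<open>y\<close> by subtracting one element of
  \<open>L\<close> and adding another one.\<close>

definition walk_kernel :: "('a, 'm) monoid_scheme \<Rightarrow> 'a set \<Rightarrow> 'a \<Rightarrow> 'a \<Rightarrow> real" where
  "walk_kernel G L y z =
     (\<Sum>a\<in>L. \<Sum>b\<in>L. of_bool (a \<otimes>\<^bsub>G\<^esub> inv\<^bsub>G\<^esub> y = b \<otimes>\<^bsub>G\<^esub> inv\<^bsub>G\<^esub> z))"

lemma walk_kernel_commute: "walk_kernel G L y z = walk_kernel G L z y"
  unfolding walk_kernel_def by (subst sum.swap) (simp add: eq_commute)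

lemma walk_kernel_nonneg: "walk_kernel G L y z \<ge> 0"
  unfolding walk_kernel_def by (simp add: sum_nonneg)

context comm_group
begin

lemma inv_mult_swap:
  assumes "a \<in> carrier G" "b \<in> carrier G" "y \<in> carrier G" "z \<in> carrier G"
  shows "a \<otimes> inv y = b \<otimes> inv z \<longleftrightarrow> z = y \<otimes> (b \<otimes> inv a)"
proof -
  have "a \<otimes> inv y = b \<otimes> inv z \<longleftrightarrow> a \<otimes> z = b \<otimes> y"
    using assms by (smt (verit) inv_closed inv_solve_left inv_solve_right m_assoc m_closed m_comm)
  also have "\<dots> \<longleftrightarrow> z = y \<otimes> (b \<otimes> inv a)"
    using assms by (smt (verit) inv_closed inv_solve_left m_assoc m_closed m_comm)
  finally show ?thesis .
qed

text \<open>Every pair \<open>(a, b)\<close> leads from \<open>y\<close> to exactly one point; the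
  inequality drops the restriction that this point lies in \<open>Y\<close>.\<close>

lemma kernel_op_walk_kernel_le:
  assumes "finite L" "L \<subseteq> carrier G" "finite Y" "Y \<subseteq> carrier G" "y \<in> carrier G" "\<And>z. R z \<ge> 0"
  shows "kernel_op Y (walk_kernel G L) R y \<le> (\<Sum>a\<in>L. \<Sum>b\<in>L. R (y \<otimes> (b \<otimes> inv a)))"
proof -
  have "kernel_op Y (walk_kernel G L) R y
      = (\<Sum>z\<in>Y. \<Sum>a\<in>L. \<Sum>b\<in>L. if z = y \<otimes> (b \<otimes> inv a) then R z else 0)"
    unfolding kernel_op_def walk_kernel_def sum_distrib_right using assms
    by (intro sum.cong refl) (simp add: inv_mult_swap subsetD)
  also have "\<dots> = (\<Sum>a\<in>L. \<Sum>b\<in>L. \<Sum>z\<in>Y. if z = y \<otimes> (b \<otimes> inv a) then R z else 0)"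
    by (subst sum.swap, rule sum.cong[OF refl], rule sum.swap)
  also have "\<dots> \<le> (\<Sum>a\<in>L. \<Sum>b\<in>L. R (y \<otimes> (b \<otimes> inv a)))"
    using assms by (intro sum_mono) (simp add: sum.delta)
  finally show ?thesis .
qed

definition alternating_sign :: "nat \<Rightarrow> int" where
  "alternating_sign i = (if even i then -1 else 1)"

text \<open>A walk of \<open>n\<close> steps is a tuple of \<open>2 * n\<close> elements of
  \<open>L\<close>, alternately subtracted and added. The right side also counts walks that leave
  \<open>Y\<close>.\<close>

lemma kernel_op_walk_kernel_funpow_le:
  assumes L: "finite L" "L \<subseteq> carrier G" and Y: "finite Y" "Y \<subseteq> carrier G"
    and y: "y \<in> carrier G" and g: "\<And>z. g z \<ge> 0"
  shows "(kernel_op Y (walk_kernel G L) ^^ n) g y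
    \<le> (\<Sum>t\<in>{..<2 * n} \<rightarrow>\<^sub>E L. g (y \<otimes> (\<Otimes>i\<in>{..<2 * n}. t i [^] alternating_sign i)))"
  using y
proof (induction n arbitrary: y)
  case 0
  then show ?case by simp
next
  case (Suc n)
  let ?T = "kernel_op Y (walk_kernel G L)"
  let ?\<Pi> = "\<lambda>m t. (\<Otimes>i\<in>{..<m}. t i [^] alternating_sign i)"
  define R where "R z = (if z \<in> carrier G then \<Sum>t\<in>{..<2 * n} \<rightarrow>\<^sub>E L. g (z \<otimes> ?\<Pi> (2 * n) t) else 0)" for z
  have R: "R z \<ge> 0" for z
    unfolding R_def by (simp add: g sum_nonneg)
  \<comment> \<open>One further step puts \<open>a\<close>, subtracted, at the even position
    \<open>2 * n\<close> and \<open>b\<close>, added, at the odd position after it.\<close>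
  have step: "y \<otimes> (b \<otimes> inv a) \<otimes> ?\<Pi> (2 * n) t = y \<otimes> ?\<Pi> (2 * Suc n) (t(2 * n := a, Suc (2 * n) := b))"
    if "a \<in> L" "b \<in> L" "t \<in> {..<2 * n} \<rightarrow>\<^sub>E L" for a b t
  proof -
    let ?t = "t(2 * n := a, Suc (2 * n) := b)"
    have t: "t i \<in> carrier G" if "i < 2 * n" for i
      using PiE_mem[OF \<open>t \<in> _\<close>] that L by blast
    have ab: "a \<in> carrier G" "b \<in> carrier G"
      using that L by auto
    have "?\<Pi> (2 * n) ?t = ?\<Pi> (2 * n) t"
      using t by (intro finprod_cong') auto
    moreover have closed: "?\<Pi> (2 * n) t \<in> carrier G"
      using t by (intro finprod_closed) auto
    moreover have "?\<Pi> (Suc (2 * n)) ?t = inv a \<otimes> ?\<Pi> (2 * n) ?t"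
      unfolding lessThan_Suc using t ab
      by (subst finprod_insert) (auto simp: alternating_sign_def int_pow_neg)
    moreover have "?\<Pi> (Suc (Suc (2 * n))) ?t = b \<otimes> ?\<Pi> (Suc (2 * n)) ?t"
      unfolding lessThan_Suc[of "Suc (2 * n)"] using t ab
      by (subst finprod_insert) (auto simp: alternating_sign_def less_Suc_eq)
    ultimately show ?thesis
      using ab Suc.prems by (simp add: m_assoc)
  qed
  have "(?T ^^ Suc n) g y \<le> ?T R y"
    unfolding funpow.simps comp_def kernel_op_def[of Y _ _ y] R_def
    using Suc.IH Y by (intro sum_mono mult_left_mono walk_kernel_nonneg) auto
  also have "\<dots> \<le> (\<Sum>a\<in>L. \<Sum>b\<in>L. R (y \<otimes> (b \<otimes> inv a)))"
    by (rule kernel_op_walk_kernel_le[OF L Y Suc.prems R])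
  also have "\<dots> = (\<Sum>a\<in>L. \<Sum>b\<in>L. \<Sum>t\<in>{..<2 * n} \<rightarrow>\<^sub>E L.
      g (y \<otimes> ?\<Pi> (2 * Suc n) (t(2 * n := a, Suc (2 * n) := b))))"
    using L Suc.prems by (intro sum.cong refl) (simp add: R_def step subsetD del: finprod_Suc)
  also have "\<dots> = (\<Sum>b\<in>L. \<Sum>a\<in>L. \<Sum>t\<in>{..<2 * n} \<rightarrow>\<^sub>E L.
      g (y \<otimes> ?\<Pi> (2 * Suc n) (t(2 * n := a, Suc (2 * n) := b))))"
    by (rule sum.swap)
  also have "\<dots> = (\<Sum>t\<in>{..<2 * Suc n} \<rightarrow>\<^sub>E L. g (y \<otimes> ?\<Pi> (2 * Suc n) t))"
    by (simp add: lessThan_Suc sum_PiE_insert)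
  finally show ?case .
qed

text \<open>
  The high moments of a dissociated set control the operator norm of convolution with it, because
  passing to the power \<open>2 ^ r\<close> of the operator costs only a factor \<open>card Y\<close>.
\<close>

lemma dissociated_walk_kernel_form_le:
  assumes L: "dissociated G L" and Y: "finite Y" "Y \<subseteq> carrier G" and g: "\<And>y. g y \<ge> 0"
    and card: "real (card Y) \<le> 4 ^ 2 ^ r" "2 * 2 ^ r \<le> card L"
  shows "(\<Sum>y\<in>Y. g y * kernel_op Y (walk_kernel G L) g y)
    \<le> 128 * 2 ^ r * real (card L) * (\<Sum>y\<in>Y. (g y)\<^sup>2)"
proof -
  have LG: "finite L" "L \<subseteq> carrier G"
    using L by (auto simp: dissociated_def)
  define n :: nat where "n = 2 ^ r"
  have n: "0 < n" "2 * n \<le> card L"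
    using card by (auto simp: n_def)
  define B where "B = (32 * real n * real (card L)) ^ n"
  have B: "B \<ge> 0" by (simp add: B_def)
  \<comment> \<open>Cut off outside \<open>Y\<close>, so that a sum over the end points of all walks
    becomes a sum over \<open>Y\<close>.\<close>
  define h where "h y = (if y \<in> Y then g y else 0)" for y
  have h: "h y \<ge> 0" for y by (simp add: h_def g)
  let ?N = "\<Sum>y\<in>Y. (g y)\<^sup>2"
  let ?Q = "\<Sum>y\<in>Y. g y * kernel_op Y (walk_kernel G L) g y"
  let ?\<Pi> = "\<lambda>t. (\<Otimes>i\<in>{..<2 * n}. t i [^] alternating_sign i)"
  let ?T = "{..<2 * n} \<rightarrow>\<^sub>E L"
  have N: "?N \<ge> 0" by (simp add: sum_nonneg)
  have Q: "?Q = (\<Sum>y\<in>Y. h y * kernel_op Y (walk_kernel G L) h y)"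
    by (simp add: h_def kernel_op_def)
  \<comment> \<open>From a given \<open>y\<close>, every \<open>z\<close> is the end point of at
    most \<open>B\<close> tuples.\<close>
  have bound: "(kernel_op Y (walk_kernel G L) ^^ n) h y \<le> B * (\<Sum>z\<in>Y. h z)" if "y \<in> Y" for y
  proof -
    have yG: "y \<in> carrier G" using that Y by auto
    have closed: "?\<Pi> t \<in> carrier G" if "t \<in> ?T" for t
      using PiE_mem[OF that] LG by (intro finprod_closed) auto
    have fin: "finite ?T" using LG by (intro finite_PiE) auto
    have "(kernel_op Y (walk_kernel G L) ^^ n) h y \<le> (\<Sum>t\<in>?T. h (y \<otimes> ?\<Pi> t))"
      by (rule kernel_op_walk_kernel_funpow_le[OF LG Y yG h])
    also have "\<dots> = (\<Sum>t\<in>?T. \<Sum>z\<in>Y. if z = y \<otimes> ?\<Pi> t then h z else 0)"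
      using Y by (intro sum.cong refl) (simp add: sum.delta h_def)
    also have "\<dots> = (\<Sum>z\<in>Y. \<Sum>t\<in>?T. if z = y \<otimes> ?\<Pi> t then h z else 0)"
      by (rule sum.swap)
    also have "\<dots> = (\<Sum>z\<in>Y. real (card {t \<in> ?T. ?\<Pi> t = inv y \<otimes> z}) * h z)"
    proof (rule sum.cong[OF refl])
      fix z assume z: "z \<in> Y"
      have "(\<Sum>t\<in>?T. if z = y \<otimes> ?\<Pi> t then h z else 0) = (\<Sum>t\<in>{t \<in> ?T. z = y \<otimes> ?\<Pi> t}. h z)"
        using fin by (intro sum.mono_neutral_cong_right) auto
      also have "{t \<in> ?T. z = y \<otimes> ?\<Pi> t} = {t \<in> ?T. ?\<Pi> t = inv y \<otimes> z}"
      proof (intro Collect_cong conj_cong refl)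
        fix t assume "t \<in> ?T"
        then show "z = y \<otimes> ?\<Pi> t \<longleftrightarrow> ?\<Pi> t = inv y \<otimes> z"
          using inv_solve_left[OF closed[of t] yG, of z] z Y(2) by blast
      qed
      finally show "(\<Sum>t\<in>?T. if z = y \<otimes> ?\<Pi> t then h z else 0) = real (card {t \<in> ?T. ?\<Pi> t = inv y \<otimes> z}) * h z"
        by simp
    qed
    also have "\<dots> \<le> (\<Sum>z\<in>Y. B * h z)"
      unfolding B_def using n
      by (intro sum_mono mult_right_mono h card_signed_product_tuples_le[OF L]) (auto simp: alternating_sign_def)
    finally show ?thesis by (simp add: sum_distrib_left)
  qed
  have hN: "(\<Sum>y\<in>Y. (h y)\<^sup>2) = ?N"
    by (simp add: h_def)
  have "?Q ^ n \<le> ?N ^ (n - 1) * (\<Sum>y\<in>Y. h y * (kernel_op Y (walk_kernel G L) ^^ n) h y)"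
    using kernel_op_quadratic_form_power[of "walk_kernel G L" h Y r, OF walk_kernel_commute walk_kernel_nonneg h]
    unfolding Q n_def hN .
  also have "\<dots> \<le> ?N ^ (n - 1) * (\<Sum>y\<in>Y. h y * (B * (\<Sum>z\<in>Y. h z)))"
    by (intro mult_left_mono sum_mono bound h zero_le_power N)
  also have "(\<Sum>y\<in>Y. h y * (B * (\<Sum>z\<in>Y. h z))) = B * (\<Sum>y\<in>Y. 1 * h y)\<^sup>2"
    by (simp add: sum_distrib_right[symmetric] power2_eq_square)
  also have "?N ^ (n - 1) * (B * (\<Sum>y\<in>Y. 1 * h y)\<^sup>2) \<le> ?N ^ (n - 1) * (B * (real (card Y) * ?N))"
    using sum_mult_power2_le[of "\<lambda>_. 1" h Y] hN B N by (intro mult_left_mono zero_le_power) auto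
  \<comment> \<open>The loss \<open>card Y\<close> is at most \<open>4 ^ n\<close> and becomes a
    factor 4 after the \<open>n\<close>-th root, which turns 32 into 128.\<close>
  also have "\<dots> \<le> ?N ^ (n - 1) * (B * (4 ^ n * ?N))"
    by (intro mult_left_mono mult_right_mono zero_le_power N B) (use card(1) in \<open>simp add: n_def\<close>)
  also have "\<dots> = ?N ^ Suc (n - 1) * 4 ^ n * B"
    by (simp add: mult_ac)
  also have "\<dots> = (128 * real n * real (card L) * ?N) ^ n"
  proof -
    have "Suc (n - 1) = n" using n by simp
    moreover have "128 * real n * real (card L) * ?N = ?N * 4 * (32 * real n * real (card L))" by simp
    ultimately show ?thesis unfolding B_def by (simp only: power_mult_distrib)
  qed
  finally have "?Q ^ n \<le> (128 * real n * real (card L) * ?N) ^ n" .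
  moreover have "?Q \<ge> 0"
    by (intro sum_nonneg mult_nonneg_nonneg g) (simp add: kernel_op_def g walk_kernel_nonneg sum_nonneg)
  ultimately have "?Q \<le> 128 * real n * real (card L) * ?N"
    using n N by (subst (asm) power_mono_iff) auto
  then show ?thesis
    by (simp add: n_def)
qed

end

section \<open>Operator norms of convolutions\<close>

text \<open>Push the weights forward along \<open>d\<close> to a function \<open>v\<close>, apply
  Cauchy-Schwarz on \<open>W\<close>, and expand the square of \<open>v\<close> into pairs with
  equal image.\<close>

lemma sum_comp_le_collision_energy:
  fixes w :: "'b \<Rightarrow> real" and h :: "'c \<Rightarrow> real"
  assumes P: "finite P" and w: "\<And>p. p \<in> P \<Longrightarrow> w p \<ge> 0"
    and W: "finite W" "\<And>x. x \<notin> W \<Longrightarrow> h x = 0"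
  shows "(\<Sum>p\<in>P. w p * h (d p))
    \<le> sqrt (\<Sum>p\<in>P. \<Sum>q\<in>P. w p * w q * of_bool (d p = d q)) * sqrt (\<Sum>x\<in>W. (h x)\<^sup>2)"
proof -
  define v where "v x = (\<Sum>p\<in>P. w p * of_bool (d p = x))" for x
  have "(\<Sum>p\<in>P. w p * h (d p)) = (\<Sum>p\<in>P. \<Sum>x\<in>W. w p * of_bool (d p = x) * h x)"
  proof (rule sum.cong[OF refl])
    fix p
    have "(\<Sum>x\<in>W. w p * of_bool (d p = x) * h x) = (\<Sum>x\<in>W. if d p = x then w p * h x else 0)"
      by (intro sum.cong) auto
    then show "w p * h (d p) = (\<Sum>x\<in>W. w p * of_bool (d p = x) * h x)"
      using W by (simp add: sum.delta')
  qed
  also have "\<dots> = (\<Sum>x\<in>W. v x * h x)"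
    unfolding v_def sum_distrib_right by (rule sum.swap)
  also have "\<dots> \<le> sqrt (\<Sum>x\<in>W. (v x)\<^sup>2) * sqrt (\<Sum>x\<in>W. (h x)\<^sup>2)"
    by (rule sum_mult_le_sqrt_mult_sqrt)
  also have "(\<Sum>x\<in>W. (v x)\<^sup>2)
      = (\<Sum>x\<in>W. \<Sum>p\<in>P. \<Sum>q\<in>P. (w p * of_bool (d p = x)) * (w q * of_bool (d q = x)))"
    unfolding v_def power2_eq_square sum_product ..
  also have "\<dots> = (\<Sum>p\<in>P. \<Sum>q\<in>P. \<Sum>x\<in>W. (w p * of_bool (d p = x)) * (w q * of_bool (d q = x)))"
    by (subst sum.swap, rule sum.cong[OF refl], rule sum.swap)
  also have "\<dots> = (\<Sum>p\<in>P. \<Sum>q\<in>P. \<Sum>x\<in>W. if d p = x then w p * w q * of_bool (d p = d q) else 0)"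
    by (intro sum.cong refl) auto
  also have "\<dots> \<le> (\<Sum>p\<in>P. \<Sum>q\<in>P. w p * w q * of_bool (d p = d q))"
    using W(1) w by (intro sum_mono) (simp add: sum.delta')
  finally show ?thesis
    by (simp add: mult_right_mono sum_nonneg)
qed

text \<open>The pairing of \<open>v\<close> with the convolution of the indicator of
  \<open>S\<close> and the reflection of \<open>u\<close> restricted to \<open>Y\<close>.\<close>

definition diff_form :: "('a, 'm) monoid_scheme \<Rightarrow> 'a set \<Rightarrow> 'a set \<Rightarrow> ('a \<Rightarrow> real) \<Rightarrow> ('a \<Rightarrow> real) \<Rightarrow> real" where
  "diff_form G S Y u v = (\<Sum>x\<in>S. \<Sum>y\<in>Y. u y * v (x \<otimes>\<^bsub>G\<^esub> inv\<^bsub>G\<^esub> y))"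

text \<open>\<open>conv_bound G m S c\<close>: convolution with the indicator of \<open>S\<close> has \<open>\<ell>\<^sup>2\<close> operator norm at
  most \<open>c\<close> on nonnegative functions whose support has at most \<open>m\<close> points.\<close>

definition conv_bound :: "('a, 'm) monoid_scheme \<Rightarrow> nat \<Rightarrow> 'a set \<Rightarrow> real \<Rightarrow> bool" where
  "conv_bound G m S c \<longleftrightarrow>
     (\<forall>Y W g h. finite Y \<and> Y \<subseteq> carrier G \<and> card Y \<le> m \<and> finite W \<and> (\<forall>y. g y \<ge> 0) \<and> (\<forall>x. x \<notin> W \<longrightarrow> h x = 0) \<longrightarrow>
        diff_form G S Y g h \<le> c * sqrt (\<Sum>y\<in>Y. (g y)\<^sup>2) * sqrt (\<Sum>x\<in>W. (h x)\<^sup>2))"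

lemma conv_boundD:
  assumes "conv_bound G m S c" "finite Y" "Y \<subseteq> carrier G" "card Y \<le> m" "finite W"
    "\<And>y. g y \<ge> 0" "\<And>x. x \<notin> W \<Longrightarrow> h x = 0"
  shows "diff_form G S Y g h \<le> c * sqrt (\<Sum>y\<in>Y. (g y)\<^sup>2) * sqrt (\<Sum>x\<in>W. (h x)\<^sup>2)"
  using assms unfolding conv_bound_def by blast

lemma conv_bound_mono:
  assumes "conv_bound G m S c" "c \<le> c'"
  shows "conv_bound G m S c'"
  unfolding conv_bound_def
proof (intro allI impI)
  fix Y W :: "'a set" and g h :: "'a \<Rightarrow> real"
  assume *: "finite Y \<and> Y \<subseteq> carrier G \<and> card Y \<le> m \<and> finite W \<and> (\<forall>y. 0 \<le> g y) \<and> (\<forall>x. x \<notin> W \<longrightarrow> h x = 0)"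
  have "diff_form G S Y g h \<le> c * sqrt (\<Sum>y\<in>Y. (g y)\<^sup>2) * sqrt (\<Sum>x\<in>W. (h x)\<^sup>2)"
    by (rule conv_boundD[OF assms(1)]) (use * in auto)
  also have "\<dots> \<le> c' * sqrt (\<Sum>y\<in>Y. (g y)\<^sup>2) * sqrt (\<Sum>x\<in>W. (h x)\<^sup>2)"
    using assms(2) by (intro mult_right_mono) (auto intro: sum_nonneg)
  finally show "diff_form G S Y g h \<le> c' * sqrt (\<Sum>y\<in>Y. (g y)\<^sup>2) * sqrt (\<Sum>x\<in>W. (h x)\<^sup>2)" .
qed

lemma diff_form_Un:
  assumes "finite S" "finite S'" "S \<inter> S' = {}"
  shows "diff_form G (S \<union> S') Y g h = diff_form G S Y g h + diff_form G S' Y g h"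
  unfolding diff_form_def using assms by (rule sum.union_disjoint)

lemma conv_bound_Un:
  assumes "conv_bound G m S c" "conv_bound G m S' c'" "finite S" "finite S'" "S \<inter> S' = {}"
  shows "conv_bound G m (S \<union> S') (c + c')"
  unfolding conv_bound_def
proof (intro allI impI)
  fix Y W :: "'a set" and g h :: "'a \<Rightarrow> real"
  assume *: "finite Y \<and> Y \<subseteq> carrier G \<and> card Y \<le> m \<and> finite W \<and> (\<forall>y. 0 \<le> g y) \<and> (\<forall>x. x \<notin> W \<longrightarrow> h x = 0)"
  have "diff_form G S Y g h \<le> c * sqrt (\<Sum>y\<in>Y. (g y)\<^sup>2) * sqrt (\<Sum>x\<in>W. (h x)\<^sup>2)"
    by (rule conv_boundD[OF assms(1)]) (use * in auto)
  moreover have "diff_form G S' Y g h \<le> c' * sqrt (\<Sum>y\<in>Y. (g y)\<^sup>2) * sqrt (\<Sum>x\<in>W. (h x)\<^sup>2)"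
    by (rule conv_boundD[OF assms(2)]) (use * in auto)
  ultimately show "diff_form G (S \<union> S') Y g h \<le> (c + c') * sqrt (\<Sum>y\<in>Y. (g y)\<^sup>2) * sqrt (\<Sum>x\<in>W. (h x)\<^sup>2)"
    using assms by (simp add: diff_form_Un distrib_right)
qed

context comm_group
begin

lemma inj_on_diff_left: "x \<in> carrier G \<Longrightarrow> Y \<subseteq> carrier G \<Longrightarrow> inj_on (\<lambda>y. x \<otimes> inv y) Y"
  by (intro inj_onI) (metis inv_closed inv_inv l_cancel subsetD)

text \<open>A single \<open>x\<close> acts through the injective map from \<open>y\<close> to
  \<open>x - y\<close>, so Cauchy-Schwarz gives norm at most 1 per element. This trivial bound
  serves for small exceptional sets.\<close>

lemma conv_bound_card:
  assumes "S \<subseteq> carrier G"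
  shows "conv_bound G m S (real (card S))"
  unfolding conv_bound_def
proof (intro allI impI)
  fix Y W and g h :: "'a \<Rightarrow> real"
  assume *: "finite Y \<and> Y \<subseteq> carrier G \<and> card Y \<le> m \<and> finite W \<and> (\<forall>y. 0 \<le> g y) \<and> (\<forall>x. x \<notin> W \<longrightarrow> h x = 0)"
  have "(\<Sum>y\<in>Y. g y * h (x \<otimes> inv y)) \<le> sqrt (\<Sum>y\<in>Y. (g y)\<^sup>2) * sqrt (\<Sum>x\<in>W. (h x)\<^sup>2)" if x: "x \<in> S" for x
  proof -
    let ?Z = "(\<lambda>y. x \<otimes> inv y) ` Y"
    have "(\<Sum>y\<in>Y. (h (x \<otimes> inv y))\<^sup>2) = (\<Sum>z\<in>?Z. (h z)\<^sup>2)"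
      using x assms * by (subst sum.reindex) (auto intro!: inj_on_diff_left)
    also have "\<dots> = (\<Sum>z\<in>?Z \<inter> W. (h z)\<^sup>2)"
      using * by (intro sum.mono_neutral_right) auto
    also have "\<dots> \<le> (\<Sum>x\<in>W. (h x)\<^sup>2)"
      using * by (intro sum_mono2) auto
    finally have le: "(\<Sum>y\<in>Y. (h (x \<otimes> inv y))\<^sup>2) \<le> (\<Sum>x\<in>W. (h x)\<^sup>2)" .
    have "(\<Sum>y\<in>Y. g y * h (x \<otimes> inv y)) \<le> sqrt (\<Sum>y\<in>Y. (g y)\<^sup>2) * sqrt (\<Sum>y\<in>Y. (h (x \<otimes> inv y))\<^sup>2)"
      by (rule sum_mult_le_sqrt_mult_sqrt)
    also have "\<dots> \<le> sqrt (\<Sum>y\<in>Y. (g y)\<^sup>2) * sqrt (\<Sum>x\<in>W. (h x)\<^sup>2)"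
      using le by (intro mult_left_mono real_sqrt_le_mono) (auto intro: sum_nonneg)
    finally show ?thesis .
  qed
  then have "diff_form G S Y g h \<le> (\<Sum>x\<in>S. sqrt (\<Sum>y\<in>Y. (g y)\<^sup>2) * sqrt (\<Sum>x\<in>W. (h x)\<^sup>2))"
    unfolding diff_form_def by (rule sum_mono)
  then show "diff_form G S Y g h \<le> real (card S) * sqrt (\<Sum>y\<in>Y. (g y)\<^sup>2) * sqrt (\<Sum>x\<in>W. (h x)\<^sup>2)"
    by (simp add: mult.assoc)
qed

text \<open>Duality squares the operator: after Cauchy-Schwarz, the collisions
  \<open>a - y = b - z\<close> weighted by \<open>g y * g z\<close> add up to the quadratic form of
  the walk kernel.\<close>

lemma dissociated_conv_bound:
  assumes L: "dissociated G L" and m: "real m \<le> 4 ^ 2 ^ r" "2 * 2 ^ r \<le> card L"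
  shows "conv_bound G m L (sqrt (128 * 2 ^ r * real (card L)))"
  unfolding conv_bound_def
proof (intro allI impI)
  fix Y W and g h :: "'a \<Rightarrow> real"
  assume *: "finite Y \<and> Y \<subseteq> carrier G \<and> card Y \<le> m \<and> finite W \<and> (\<forall>y. 0 \<le> g y) \<and> (\<forall>x. x \<notin> W \<longrightarrow> h x = 0)"
  have L': "finite L"
    using L by (simp add: dissociated_def)
  define d where "d p = (case p of (a, y) \<Rightarrow> a \<otimes> inv y)" for p
  have "diff_form G L Y g h = (\<Sum>p\<in>L \<times> Y. g (snd p) * h (d p))"
    by (simp add: diff_form_def sum.cartesian_product d_def case_prod_unfold)
  also have "\<dots> \<le> sqrt (\<Sum>p\<in>L \<times> Y. \<Sum>q\<in>L \<times> Y. g (snd p) * g (snd q) * of_bool (d p = d q)) * sqrt (\<Sum>x\<in>W. (h x)\<^sup>2)"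
    using L' * by (intro sum_comp_le_collision_energy) auto
  also have "(\<Sum>p\<in>L \<times> Y. \<Sum>q\<in>L \<times> Y. g (snd p) * g (snd q) * of_bool (d p = d q))
      = (\<Sum>a\<in>L. \<Sum>y\<in>Y. \<Sum>b\<in>L. \<Sum>z\<in>Y. g y * g z * of_bool (a \<otimes> inv y = b \<otimes> inv z))"
    by (simp add: sum.cartesian_product' d_def)
  also have "\<dots> = (\<Sum>y\<in>Y. \<Sum>a\<in>L. \<Sum>z\<in>Y. \<Sum>b\<in>L. g y * g z * of_bool (a \<otimes> inv y = b \<otimes> inv z))"
    by (subst sum.swap) (intro sum.cong refl sum.swap)
  also have "\<dots> = (\<Sum>y\<in>Y. \<Sum>z\<in>Y. \<Sum>a\<in>L. \<Sum>b\<in>L. g y * g z * of_bool (a \<otimes> inv y = b \<otimes> inv z))"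
    by (intro sum.cong refl sum.swap)
  also have "\<dots> = (\<Sum>y\<in>Y. g y * kernel_op Y (walk_kernel G L) g y)"
    unfolding kernel_op_def walk_kernel_def sum_distrib_left sum_distrib_right
    by (intro sum.cong refl) simp
  also have "\<dots> \<le> 128 * 2 ^ r * real (card L) * (\<Sum>y\<in>Y. (g y)\<^sup>2)"
  proof (rule dissociated_walk_kernel_form_le[OF L])
    show "real (card Y) \<le> 4 ^ 2 ^ r"
      using * m(1) by (meson of_nat_le_iff order_trans)
  qed (use * m in auto)
  finally show "diff_form G L Y g h \<le> sqrt (128 * 2 ^ r * real (card L)) * sqrt (\<Sum>y\<in>Y. (g y)\<^sup>2) * sqrt (\<Sum>x\<in>W. (h x)\<^sup>2)"
    by (simp add: mult_right_mono real_sqrt_mult sum_nonneg)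
qed

text \<open>Greedily exhausting \<open>S\<close> by dissociated sets of size \<open>k\<close>, the operator norms add up.\<close>

lemma conv_bound_if_no_large_low_dim_subset:
  assumes "finite S" "S \<subseteq> carrier G" and m: "real m \<le> 4 ^ 2 ^ r" "2 * 2 ^ r \<le> k"
    and rich: "\<And>B. B \<subseteq> S \<Longrightarrow> real (card B) \<ge> \<sigma> \<Longrightarrow> \<exists>L\<subseteq>B. dissociated G L \<and> card L = k"
  shows "\<exists>R\<subseteq>S. real (card R) \<le> max 0 \<sigma> \<and> conv_bound G m (S - R) (real (card S) * sqrt (128 * 2 ^ r / real k))"
  using assms(1,2,5)
proof (induction S rule: finite_psubset_induct)
  case (psubset S)
  have k: "k > 0"
    using m(2) by (metis gr0I mult_is_0 not_one_le_zero numeral_neq_zero power_eq_0_iff le_zero_eq)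
  show ?case
  proof (cases "real (card S) \<ge> \<sigma>")
    case False
    \<comment> \<open>Below the threshold \<open>\<sigma>\<close> all of \<open>S\<close> becomes
      the remainder.\<close>
    have "conv_bound G m {} (real (card S) * sqrt (128 * 2 ^ r / real k))"
      by (simp add: conv_bound_def diff_form_def sum_nonneg)
    then show ?thesis
      using False by (intro exI[of _ S]) auto
  next
    case True
    then obtain L where L: "L \<subseteq> S" "dissociated G L" "card L = k"
      using psubset.prems(2)[of S] by blast
    have fL: "finite L"
      using L(1) psubset.hyps finite_subset by blast
    have "L \<noteq> {}"
      using L(3) k by auto
    then have sub: "S - L \<subset> S"
      using L(1) by blast
    have "\<exists>R\<subseteq>S - L. real (card R) \<le> max 0 \<sigma> \<and>
        conv_bound G m (S - L - R) (real (card (S - L)) * sqrt (128 * 2 ^ r / real k))"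
    proof (rule psubset.IH[OF sub])
      show "S - L \<subseteq> carrier G"
        using psubset.prems(1) by blast
      show "\<exists>L'\<subseteq>B. dissociated G L' \<and> card L' = k" if "B \<subseteq> S - L" "\<sigma> \<le> real (card B)" for B
        using psubset.prems(2)[of B] that by blast
    qed
    then obtain R where R: "R \<subseteq> S - L" "real (card R) \<le> max 0 \<sigma>"
      "conv_bound G m (S - L - R) (real (card (S - L)) * sqrt (128 * 2 ^ r / real k))"
      by blast
    \<comment> \<open>The norm for one dissociated set is its size \<open>k\<close> times a fixed
      cost per element, so successive sets add up to at most \<open>card S\<close> times this
      cost.\<close>
    have "sqrt (128 * 2 ^ r * real k) = sqrt (128 * 2 ^ r / real k * (real k)\<^sup>2)"
      using k by (simp add: power2_eq_square)
    also have "\<dots> = real k * sqrt (128 * 2 ^ r / real k)"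
      by (simp only: real_sqrt_mult real_sqrt_abs) simp
    finally have "conv_bound G m L (real k * sqrt (128 * 2 ^ r / real k))"
      using dissociated_conv_bound[OF L(2) m(1)] m(2) L(3) by simp
    then have "conv_bound G m (L \<union> (S - L - R))
        (real k * sqrt (128 * 2 ^ r / real k) + real (card (S - L)) * sqrt (128 * 2 ^ r / real k))"
      using R(3) fL psubset.hyps by (intro conv_bound_Un) auto
    moreover have "L \<union> (S - L - R) = S - R"
      using R(1) L(1) by blast
    moreover have "real k + real (card (S - L)) = real (card S)"
      using L fL psubset.hyps card_mono[of S L] by (simp add: card_Diff_subset of_nat_diff)
    ultimately have "conv_bound G m (S - R) (real (card S) * sqrt (128 * 2 ^ r / real k))"
      by (metis distrib_right)
    then show ?thesis
      using R by blast
  qed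
qed

end

subsection \<open>Slices and correlations\<close>

text \<open>Divide by \<open>sqrt x\<close>. This serves where a convolution is tested against
  itself, so that the bounded quantity recurs under the root.\<close>

lemma le_power2_if_le_mult_sqrt:
  fixes x t :: real
  assumes "x \<le> t * sqrt x" "x \<ge> 0"
  shows "x \<le> t\<^sup>2"
proof (cases "x = 0")
  case False
  then have "sqrt x * sqrt x \<le> t * sqrt x" "sqrt x > 0"
    using assms by auto
  then have "sqrt x \<le> t"
    by (simp only: mult_le_cancel_right_pos)
  then show ?thesis
    using assms(2) by (simp add: real_sqrt_le_iff sqrt_le_D)
qed auto

context comm_group
begin

definition diff_set :: "'a set \<Rightarrow> 'a set" where
  "diff_set A = {x \<in> carrier G. autocorr G A x \<noteq> 0}"

definition slice :: "'a set \<Rightarrow> 'a \<Rightarrow> 'a set" where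
  "slice A s = {a \<in> A. a \<otimes> inv s \<in> A}"

lemma diff_diff_cancel:
  assumes "a \<in> carrier G" "b \<in> carrier G"
  shows "a \<otimes> inv (a \<otimes> inv b) = b"
  using assms by (simp add: inv_mult m_assoc[symmetric])

lemma autocorr_eq_card_slice:
  assumes "A \<subseteq> carrier G" "s \<in> carrier G"
  shows "autocorr G A s = card (slice A s)"
proof -
  have "{(b, a). b \<in> A \<and> a \<in> A \<and> a \<otimes> inv b = s} = (\<lambda>a. (a \<otimes> inv s, a)) ` slice A s"
    using assms by (force simp: slice_def image_iff diff_diff_cancel subsetD)
  moreover have "inj_on (\<lambda>a. (a \<otimes> inv s, a)) (slice A s)"
    by (auto intro: inj_onI)
  ultimately show ?thesis
    by (simp add: autocorr_def card_image)
qed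

context
  fixes A :: "'a set"
  assumes A: "finite A" "A \<subseteq> carrier G"
begin

lemma finite_slice: "finite (slice A s)"
  using A(1) by (simp add: slice_def)

lemma slice_subset: "slice A s \<subseteq> A"
  by (auto simp: slice_def)

lemma autocorr_le_card: "autocorr G A s \<le> card A" if "s \<in> carrier G"
  using A that by (simp add: autocorr_eq_card_slice card_mono slice_subset)

lemma autocorr_eq_0: "autocorr G A s = 0" if "s \<notin> diff_set A"
proof (cases "s \<in> carrier G")
  case False
  then have "{(b, a). b \<in> A \<and> a \<in> A \<and> a \<otimes> inv b = s} = {}"
    using A by auto
  then show ?thesis
    by (simp only: autocorr_def card.empty)
qed (use that in \<open>simp add: diff_set_def\<close>)

lemma diff_set_eq: "diff_set A = (\<lambda>(a, b). a \<otimes> inv b) ` (A \<times> A)"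
proof -
  have fin: "finite {(b, a). b \<in> A \<and> a \<in> A \<and> a \<otimes> inv b = s}" for s
    by (rule finite_subset[of _ "A \<times> A"]) (use A in auto)
  show ?thesis
    using A unfolding diff_set_def autocorr_def
    by (auto simp: fin image_iff subsetD)
qed

lemma finite_diff_set: "finite (diff_set A)"
  using A by (simp add: diff_set_eq)

lemma diff_set_subset: "diff_set A \<subseteq> carrier G"
  by (auto simp: diff_set_def)

lemma card_diff_set_le: "card (diff_set A) \<le> (card A)\<^sup>2"
  unfolding diff_set_eq power2_eq_square using A
  by (metis card_cartesian_product card_image_le finite_cartesian_product)

lemma sum_pairs_eq_sum_slices:
  fixes \<phi> :: "'a \<Rightarrow> 'a \<Rightarrow> real"
  shows "(\<Sum>a\<in>A. \<Sum>b\<in>A. \<phi> a b) = (\<Sum>s\<in>diff_set A. \<Sum>a\<in>slice A s. \<phi> a (a \<otimes> inv s))"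
proof -
  have "(\<Sum>a\<in>A. \<Sum>b\<in>A. \<phi> a b) = (\<Sum>(a, b)\<in>A \<times> A. \<phi> a b)"
    by (simp add: sum.cartesian_product)
  also have "\<dots> = (\<Sum>(s, a)\<in>Sigma (diff_set A) (slice A). \<phi> a (a \<otimes> inv s))"
  proof (rule sum.reindex_bij_witness[where i = "\<lambda>(s, a). (a, a \<otimes> inv s)" and j = "\<lambda>(a, b). (a \<otimes> inv b, a)"])
    fix p assume p: "p \<in> A \<times> A"
    then obtain a b where [simp]: "p = (a, b)" and ab: "a \<in> A" "b \<in> A"
      by auto
    with A have G: "a \<in> carrier G" "b \<in> carrier G" by auto
    show "(case case p of (a, b) \<Rightarrow> (a \<otimes> inv b, a) of (s, a) \<Rightarrow> (a, a \<otimes> inv s)) = p"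
      by (simp add: diff_diff_cancel G)
    show "(case p of (a, b) \<Rightarrow> (a \<otimes> inv b, a)) \<in> Sigma (diff_set A) (slice A)"
      using ab by (auto simp: slice_def diff_diff_cancel G diff_set_eq)
    show "(case case p of (a, b) \<Rightarrow> (a \<otimes> inv b, a) of (s, a) \<Rightarrow> \<phi> a (a \<otimes> inv s)) = (case p of (a, b) \<Rightarrow> \<phi> a b)"
      by (simp add: diff_diff_cancel G)
  next
    fix p assume p: "p \<in> Sigma (diff_set A) (slice A)"
    then obtain s a where [simp]: "p = (s, a)" and *: "s \<in> diff_set A" "a \<in> A" "a \<otimes> inv s \<in> A"
      by (auto simp: slice_def)
    then have G: "s \<in> carrier G" "a \<in> carrier G"
      using A diff_set_subset by auto
    show "(case case p of (s, a) \<Rightarrow> (a, a \<otimes> inv s) of (a, b) \<Rightarrow> (a \<otimes> inv b, a)) = p"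
      using G by (simp add: diff_diff_cancel)
    show "(case p of (s, a) \<Rightarrow> (a, a \<otimes> inv s)) \<in> A \<times> A"
      using * by simp
  qed
  finally show ?thesis
    using finite_diff_set finite_slice by (simp add: sum.Sigma)
qed

lemma sum_diffs_eq_sum_autocorr:
  fixes \<psi> :: "'a \<Rightarrow> real"
  shows "(\<Sum>a\<in>A. \<Sum>b\<in>A. \<psi> (a \<otimes> inv b)) = (\<Sum>s\<in>diff_set A. real (autocorr G A s) * \<psi> s)"
proof -
  have "(\<Sum>a\<in>A. \<Sum>b\<in>A. \<psi> (a \<otimes> inv b)) = (\<Sum>s\<in>diff_set A. \<Sum>a\<in>slice A s. \<psi> (a \<otimes> inv (a \<otimes> inv s)))"
    by (rule sum_pairs_eq_sum_slices)
  also have "\<dots> = (\<Sum>s\<in>diff_set A. \<Sum>a\<in>slice A s. \<psi> s)"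
  proof (intro sum.cong refl)
    fix s a assume "s \<in> diff_set A" "a \<in> slice A s"
    then have G: "s \<in> carrier G" "a \<in> carrier G"
      using A diff_set_subset slice_subset by blast+
    then show "\<psi> (a \<otimes> inv (a \<otimes> inv s)) = \<psi> s"
      by (simp add: diff_diff_cancel)
  qed
  also have "\<dots> = (\<Sum>s\<in>diff_set A. real (autocorr G A s) * \<psi> s)"
    using A by (intro sum.cong refl) (simp add: autocorr_eq_card_slice diff_set_def)
  finally show ?thesis .
qed

lemma sum_autocorr: "(\<Sum>s\<in>diff_set A. real (autocorr G A s)) = (real (card A))\<^sup>2"
  using sum_diffs_eq_sum_autocorr[of "\<lambda>_. 1"] by (simp add: power2_eq_square)

section \<open>Norm bounds applied to autocorrelations\<close>

text \<open>With \<open>g = 1\<close> and the autocorrelation itself as \<open>h\<close>, the form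
  is the additive energy of \<open>A\<close>, which is also the square sum of
  \<open>h\<close>.\<close>

lemma sum_autocorr_power2_le:
  assumes "conv_bound G m A c" "card A \<le> m"
  shows "(\<Sum>s\<in>diff_set A. (real (autocorr G A s))\<^sup>2) \<le> c\<^sup>2 * real (card A)"
proof -
  let ?E = "\<Sum>s\<in>diff_set A. (real (autocorr G A s))\<^sup>2"
  have "?E = diff_form G A A (\<lambda>_. 1) (\<lambda>s. real (autocorr G A s))"
    unfolding diff_form_def mult_1
    by (subst sum_diffs_eq_sum_autocorr) (simp add: power2_eq_square)
  also have "\<dots> \<le> c * sqrt (\<Sum>y\<in>A. 1\<^sup>2) * sqrt ?E"
    using A assms finite_diff_set by (intro conv_boundD[OF assms(1)]) (auto simp: autocorr_eq_0)
  finally have "?E \<le> (c * sqrt (real (card A)))\<^sup>2"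
    by (intro le_power2_if_le_mult_sqrt) (auto simp: sum_nonneg)
  then show ?thesis
    by (simp add: power_mult_distrib)
qed

text \<open>Let \<open>H\<close> be the convolution of \<open>A\<close> with the reflection of
  \<open>g\<close>. The left side equals both the form in \<open>g\<close> and \<open>H\<close> and
  the square sum of \<open>H\<close>, so the norm bound for \<open>A\<close> bounds it by its own
  root.\<close>

lemma sum_autocorr_correlation_le:
  assumes c: "conv_bound G m A c" and Q: "finite Q" "Q \<subseteq> carrier G" "card Q \<le> m"
    and g: "\<And>y. g y \<ge> 0" "\<And>y. y \<notin> Q \<Longrightarrow> g y = 0"
  shows "(\<Sum>s\<in>diff_set A. real (autocorr G A s) * (\<Sum>y\<in>Q. g y * g (y \<otimes> inv s))) \<le> c\<^sup>2 * (\<Sum>y\<in>Q. (g y)\<^sup>2)"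
    (is "?S \<le> _")
proof -
  define Z where "Z = (\<lambda>(a, y). a \<otimes> inv y) ` (A \<times> Q)"
  define H where "H z = (if z \<in> Z then \<Sum>a\<in>A. g (a \<otimes> inv z) else 0)" for z
  have Z: "finite Z" "Z \<subseteq> carrier G"
    using A Q by (auto simp: Z_def)
  have form: "diff_form G A Q g H = ?S"
  proof -
    have "diff_form G A Q g H = (\<Sum>a\<in>A. \<Sum>y\<in>Q. \<Sum>b\<in>A. g y * g (y \<otimes> inv (a \<otimes> inv b)))"
      unfolding diff_form_def
    proof (intro sum.cong refl)
      fix a y assume a: "a \<in> A" and y: "y \<in> Q"
      have "b \<otimes> inv (a \<otimes> inv y) = y \<otimes> inv (a \<otimes> inv b)" if "b \<in> A" for b
      proof -
        have G: "a \<in> carrier G" "y \<in> carrier G" "b \<in> carrier G"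
          using a y that A Q by auto
        then have "b \<otimes> inv (a \<otimes> inv y) = inv a \<otimes> y \<otimes> b" "y \<otimes> inv (a \<otimes> inv b) = inv a \<otimes> b \<otimes> y"
          by (simp_all add: inv_mult m_ac)
        then show ?thesis
          using G by (simp add: m_ac)
      qed
      then show "g y * H (a \<otimes> inv y) = (\<Sum>b\<in>A. g y * g (y \<otimes> inv (a \<otimes> inv b)))"
        using a y by (auto simp: H_def Z_def sum_distrib_left)
    qed
    also have "\<dots> = (\<Sum>a\<in>A. \<Sum>b\<in>A. \<Sum>y\<in>Q. g y * g (y \<otimes> inv (a \<otimes> inv b)))"
      by (intro sum.cong refl sum.swap)
    finally show ?thesis
      by (simp only: sum_diffs_eq_sum_autocorr[of "\<lambda>s. \<Sum>y\<in>Q. g y * g (y \<otimes> inv s)"])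
  qed
  have "(\<Sum>z\<in>Z. (H z)\<^sup>2) = (\<Sum>a\<in>A. \<Sum>z\<in>Z. g (a \<otimes> inv z) * H z)"
    unfolding power2_eq_square by (subst sum.swap) (simp add: H_def sum_distrib_right)
  also have "\<dots> = (\<Sum>a\<in>A. \<Sum>y\<in>Q. g y * H (a \<otimes> inv y))"
  proof (rule sum.cong[OF refl])
    fix a assume a: "a \<in> A"
    then have aG: "a \<in> carrier G" using A by auto
    have "(\<Sum>y\<in>Q. g y * H (a \<otimes> inv y)) = (\<Sum>y\<in>Q. g (a \<otimes> inv (a \<otimes> inv y)) * H (a \<otimes> inv y))"
      using aG Q by (intro sum.cong refl) (simp add: diff_diff_cancel subsetD)
    also have "\<dots> = (\<Sum>z\<in>(\<lambda>y. a \<otimes> inv y) ` Q. g (a \<otimes> inv z) * H z)"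
      using aG Q by (subst sum.reindex) (auto intro!: inj_on_diff_left)
    also have "\<dots> = (\<Sum>z\<in>Z. g (a \<otimes> inv z) * H z)"
    proof (rule sum.mono_neutral_left[OF Z(1)])
      show "(\<lambda>y. a \<otimes> inv y) ` Q \<subseteq> Z"
        using a by (auto simp: Z_def)
      show "\<forall>z\<in>Z - (\<lambda>y. a \<otimes> inv y) ` Q. g (a \<otimes> inv z) * H z = 0"
      proof
        fix z assume z: "z \<in> Z - (\<lambda>y. a \<otimes> inv y) ` Q"
        then have "z = a \<otimes> inv (a \<otimes> inv z)"
          using diff_diff_cancel aG Z by auto
        then have "a \<otimes> inv z \<notin> Q"
          using z by blast
        then show "g (a \<otimes> inv z) * H z = 0"
          using g(2) by simp
      qed
    qed
    finally show "(\<Sum>z\<in>Z. g (a \<otimes> inv z) * H z) = (\<Sum>y\<in>Q. g y * H (a \<otimes> inv y))" ..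
  qed
  finally have H: "(\<Sum>z\<in>Z. (H z)\<^sup>2) = ?S"
    using form unfolding diff_form_def by simp
  have "diff_form G A Q g H \<le> c * sqrt (\<Sum>y\<in>Q. (g y)\<^sup>2) * sqrt (\<Sum>z\<in>Z. (H z)\<^sup>2)"
    by (intro conv_boundD[OF c] Q Z g) (auto simp: H_def)
  then have "?S \<le> c * sqrt (\<Sum>y\<in>Q. (g y)\<^sup>2) * sqrt ?S"
    by (simp only: form H)
  moreover have "?S \<ge> 0"
    using g by (intro sum_nonneg mult_nonneg_nonneg) auto
  ultimately have "?S \<le> (c * sqrt (\<Sum>y\<in>Q. (g y)\<^sup>2))\<^sup>2"
    by (rule le_power2_if_le_mult_sqrt)
  then show ?thesis
    by (simp add: power_mult_distrib sum_nonneg)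
qed

text \<open>
  Expanding \<open>\<Sum>b. (\<Sum>a. f (a - b))\<^sup>2\<close> and grouping by \<open>s = a - a'\<close> produces convolutions with the slices
  \<open>A \<inter> (A + s)\<close>, so the operator norm bound enters twice: for the slices, and for \<open>A\<close> itself in
  the resulting correlations of \<open>f\<^sup>2\<close>.
\<close>

lemma sum_autocorr_mult_power2_le:
  assumes A0: "A \<noteq> {}" and m: "card A \<le> m" "card Q \<le> m"
    and c: "conv_bound G m A c" "c \<ge> 0"
    and R: "\<And>s. R s \<subseteq> slice A s" "\<And>s. real (card (R s)) \<le> \<sigma>"
      "\<And>s. conv_bound G m (slice A s - R s) (real (card (slice A s)) * \<kappa>)" and \<kappa>: "\<kappa> \<ge> 0"
    and Q: "Q \<subseteq> diff_set A" and f: "\<And>x. f x \<ge> 0" "\<And>x. x \<notin> Q \<Longrightarrow> f x = 0"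
  shows "(\<Sum>s\<in>Q. real (autocorr G A s) * f s)\<^sup>2
    \<le> real (card A) * (\<kappa> * sqrt (real (card A)) * (real (card A) * (c * sqrt (\<Sum>s\<in>Q. f s ^ 4))) + \<sigma> * (\<Sum>s\<in>Q. f s)\<^sup>2)"
proof -
  let ?D = "diff_set A" and ?\<alpha> = "real (card A)"
  let ?\<phi> = "\<lambda>s. \<Sum>y\<in>Q. (f y)\<^sup>2 * (f (y \<otimes> inv s))\<^sup>2"
  define h where "h s y = f y * f (y \<otimes> inv s)" for s y
  have Q': "finite Q" "Q \<subseteq> carrier G"
    using Q finite_diff_set diff_set_subset finite_subset by blast+
  have \<sigma>: "\<sigma> \<ge> 0"
    using R(2)[of \<one>] by linarith
  have "(\<Sum>s\<in>Q. real (autocorr G A s) * f s) = (\<Sum>s\<in>?D. real (autocorr G A s) * f s)"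
    using Q finite_diff_set f by (intro sum.mono_neutral_left) auto
  also have "\<dots> = (\<Sum>a\<in>A. \<Sum>b\<in>A. f (a \<otimes> inv b))"
    by (rule sum_diffs_eq_sum_autocorr[symmetric])
  also have "\<dots> = (\<Sum>b\<in>A. 1 * (\<Sum>a\<in>A. f (a \<otimes> inv b)))"
    by (subst sum.swap) simp
  finally have "(\<Sum>s\<in>Q. real (autocorr G A s) * f s)\<^sup>2 = (\<Sum>b\<in>A. 1 * (\<Sum>a\<in>A. f (a \<otimes> inv b)))\<^sup>2"
    by simp
  also have "\<dots> \<le> (\<Sum>b\<in>A. 1\<^sup>2) * (\<Sum>b\<in>A. (\<Sum>a\<in>A. f (a \<otimes> inv b))\<^sup>2)"
    by (rule sum_mult_power2_le)
  finally have 1: "(\<Sum>s\<in>Q. real (autocorr G A s) * f s)\<^sup>2 \<le> ?\<alpha> * (\<Sum>b\<in>A. (\<Sum>a\<in>A. f (a \<otimes> inv b))\<^sup>2)"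
    by simp
  have "(\<Sum>b\<in>A. (\<Sum>a\<in>A. f (a \<otimes> inv b))\<^sup>2) = (\<Sum>b\<in>A. \<Sum>a\<in>A. \<Sum>a'\<in>A. f (a \<otimes> inv b) * f (a' \<otimes> inv b))"
    by (simp add: power2_eq_square sum_product)
  also have "\<dots> = (\<Sum>a\<in>A. \<Sum>a'\<in>A. \<Sum>b\<in>A. f (a \<otimes> inv b) * f (a' \<otimes> inv b))"
    by (subst sum.swap, rule sum.cong[OF refl], rule sum.swap)
  also have "\<dots> = (\<Sum>s\<in>?D. \<Sum>a\<in>slice A s. \<Sum>b\<in>A. f (a \<otimes> inv b) * f (a \<otimes> inv s \<otimes> inv b))"
    by (rule sum_pairs_eq_sum_slices)
  also have "\<dots> = (\<Sum>s\<in>?D. diff_form G (slice A s) A (\<lambda>_. 1) (h s))"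
    unfolding diff_form_def h_def
  proof (intro sum.cong refl)
    fix s a b assume "s \<in> ?D" "a \<in> slice A s" "b \<in> A"
    then have "s \<in> carrier G" "a \<in> carrier G" "b \<in> carrier G"
      using A diff_set_subset slice_subset by blast+
    then have "a \<otimes> inv s \<otimes> inv b = a \<otimes> inv b \<otimes> inv s"
      by (simp add: m_ac)
    then show "f (a \<otimes> inv b) * f (a \<otimes> inv s \<otimes> inv b) = 1 * (f (a \<otimes> inv b) * f (a \<otimes> inv b \<otimes> inv s))"
      by simp
  qed
  also have "\<dots> \<le> (\<Sum>s\<in>?D. real (autocorr G A s) * \<kappa> * sqrt ?\<alpha> * sqrt (?\<phi> s) + \<sigma> * (\<Sum>y\<in>Q. h s y))"
  proof (rule sum_mono)
    fix s assume s: "s \<in> ?D"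
    then have sG: "s \<in> carrier G" using diff_set_subset by blast
    have fin: "finite (R s)" "finite (slice A s - R s)"
      using R(1)[of s] finite_slice finite_subset by blast+
    have "slice A s = (slice A s - R s) \<union> R s"
      using R(1)[of s] by blast
    then have "diff_form G (slice A s) A (\<lambda>_. 1) (h s)
        = diff_form G (slice A s - R s) A (\<lambda>_. 1) (h s) + diff_form G (R s) A (\<lambda>_. 1) (h s)"
      using diff_form_Un[OF fin(2,1), of G A "\<lambda>_. 1" "h s"] by auto
    moreover have "diff_form G (slice A s - R s) A (\<lambda>_. 1) (h s)
        \<le> real (card (slice A s)) * \<kappa> * sqrt (\<Sum>y\<in>A. 1\<^sup>2) * sqrt (\<Sum>y\<in>Q. (h s y)\<^sup>2)"
      using A m Q' f by (intro conv_boundD[OF R(3)]) (auto simp: h_def)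
    \<comment> \<open>Each element \<open>a\<close> of the remainder costs at most the full sum of
      \<open>h s\<close>, since \<open>b\<close> is determined by \<open>a - b\<close>.\<close>
    moreover have "diff_form G (R s) A (\<lambda>_. 1) (h s) \<le> (\<Sum>a\<in>R s. \<Sum>y\<in>Q. h s y)"
      unfolding diff_form_def
    proof (rule sum_mono)
      fix a assume "a \<in> R s"
      then have aG: "a \<in> carrier G"
        using R(1) slice_subset A by blast
      have "(\<Sum>b\<in>A. 1 * h s (a \<otimes> inv b)) = (\<Sum>y\<in>(\<lambda>b. a \<otimes> inv b) ` A. h s y)"
        using aG A by (subst sum.reindex) (auto intro!: inj_on_diff_left)
      also have "\<dots> = (\<Sum>y\<in>(\<lambda>b. a \<otimes> inv b) ` A \<inter> Q. h s y)"
        using A f by (intro sum.mono_neutral_right) (auto simp: h_def)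
      also have "\<dots> \<le> (\<Sum>y\<in>Q. h s y)"
        using Q' f by (intro sum_mono2) (auto simp: h_def)
      finally show "(\<Sum>b\<in>A. 1 * h s (a \<otimes> inv b)) \<le> (\<Sum>y\<in>Q. h s y)" .
    qed
    moreover have "(\<Sum>a\<in>R s. \<Sum>y\<in>Q. h s y) \<le> \<sigma> * (\<Sum>y\<in>Q. h s y)"
      using R(2)[of s] f by (simp add: h_def mult_right_mono sum_nonneg)
    ultimately show "diff_form G (slice A s) A (\<lambda>_. 1) (h s)
        \<le> real (autocorr G A s) * \<kappa> * sqrt ?\<alpha> * sqrt (?\<phi> s) + \<sigma> * (\<Sum>y\<in>Q. h s y)"
      using A sG by (simp add: autocorr_eq_card_slice h_def power_mult_distrib)
  qed
  \<comment> \<open>The autocorrelation is split into two roots, so that Cauchy-Schwarz separates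
    its total, the square of \<open>card A\<close>, from the weighted correlations
    \<open>?\<phi> s\<close>.\<close>
  also have "\<dots> = \<kappa> * sqrt ?\<alpha> * (\<Sum>s\<in>?D. sqrt (real (autocorr G A s)) * sqrt (real (autocorr G A s) * ?\<phi> s))
      + \<sigma> * (\<Sum>s\<in>?D. \<Sum>y\<in>Q. h s y)"
  proof -
    have "sqrt (real n) * sqrt (real n * x) = real n * sqrt x" for n x
      by (simp add: real_sqrt_mult mult.assoc[symmetric])
    then show ?thesis
      by (simp only: sum.distrib) (simp add: sum_distrib_left mult_ac)
  qed
  also have "(\<Sum>s\<in>?D. sqrt (real (autocorr G A s)) * sqrt (real (autocorr G A s) * ?\<phi> s))
      \<le> sqrt (\<Sum>s\<in>?D. (sqrt (real (autocorr G A s)))\<^sup>2) * sqrt (\<Sum>s\<in>?D. (sqrt (real (autocorr G A s) * ?\<phi> s))\<^sup>2)"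
    by (rule sum_mult_le_sqrt_mult_sqrt)
  also have "(\<Sum>s\<in>?D. (sqrt (real (autocorr G A s)))\<^sup>2) = ?\<alpha>\<^sup>2"
    by (simp add: sum_autocorr)
  also have "(\<Sum>s\<in>?D. (sqrt (real (autocorr G A s) * ?\<phi> s))\<^sup>2) = (\<Sum>s\<in>?D. real (autocorr G A s) * ?\<phi> s)"
    by (simp add: sum_nonneg)
  also have "\<dots> \<le> c\<^sup>2 * (\<Sum>y\<in>Q. ((f y)\<^sup>2)\<^sup>2)"
    using f m Q' by (intro sum_autocorr_correlation_le[OF c(1)]) auto
  \<comment> \<open>For fixed \<open>y\<close> the points \<open>y - s\<close> are distinct, so the
    sum over \<open>s\<close> is at most the sum of \<open>f\<close> over \<open>Q\<close>.\<close>
  also have "(\<Sum>s\<in>?D. \<Sum>y\<in>Q. h s y) \<le> (\<Sum>s\<in>Q. f s)\<^sup>2"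
  proof -
    have "(\<Sum>s\<in>?D. \<Sum>y\<in>Q. h s y) = (\<Sum>y\<in>Q. f y * (\<Sum>s\<in>?D. f (y \<otimes> inv s)))"
      unfolding h_def sum_distrib_left by (rule sum.swap)
    also have "\<dots> \<le> (\<Sum>y\<in>Q. f y * (\<Sum>z\<in>Q. f z))"
    proof (intro sum_mono mult_left_mono f)
      fix y assume "y \<in> Q"
      then have yG: "y \<in> carrier G" using Q' by blast
      have "(\<Sum>s\<in>?D. f (y \<otimes> inv s)) = (\<Sum>z\<in>(\<lambda>s. y \<otimes> inv s) ` ?D. f z)"
        using yG diff_set_subset by (subst sum.reindex) (auto intro!: inj_on_diff_left)
      also have "\<dots> = (\<Sum>z\<in>(\<lambda>s. y \<otimes> inv s) ` ?D \<inter> Q. f z)"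
        using finite_diff_set f by (intro sum.mono_neutral_right) auto
      also have "\<dots> \<le> (\<Sum>z\<in>Q. f z)"
        using Q' f by (intro sum_mono2) auto
      finally show "(\<Sum>s\<in>?D. f (y \<otimes> inv s)) \<le> (\<Sum>z\<in>Q. f z)" .
    qed
    finally show ?thesis
      by (simp add: power2_eq_square sum_distrib_right)
  qed
  finally have 2: "(\<Sum>b\<in>A. (\<Sum>a\<in>A. f (a \<otimes> inv b))\<^sup>2)
      \<le> \<kappa> * sqrt ?\<alpha> * (sqrt (?\<alpha>\<^sup>2) * sqrt (c\<^sup>2 * (\<Sum>y\<in>Q. ((f y)\<^sup>2)\<^sup>2))) + \<sigma> * (\<Sum>s\<in>Q. f s)\<^sup>2"
    using \<kappa> \<sigma> by (simp add: mult_left_mono add_mono)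
  have eq: "sqrt (?\<alpha>\<^sup>2) * sqrt (c\<^sup>2 * (\<Sum>y\<in>Q. ((f y)\<^sup>2)\<^sup>2)) = ?\<alpha> * (c * sqrt (\<Sum>s\<in>Q. f s ^ 4))"
    using c(2) by (simp add: real_sqrt_mult power_mult[symmetric])
  note 1
  also have "?\<alpha> * (\<Sum>b\<in>A. (\<Sum>a\<in>A. f (a \<otimes> inv b))\<^sup>2)
      \<le> ?\<alpha> * (\<kappa> * sqrt ?\<alpha> * (?\<alpha> * (c * sqrt (\<Sum>s\<in>Q. f s ^ 4))) + \<sigma> * (\<Sum>s\<in>Q. f s)\<^sup>2)"
    by (rule mult_left_mono[OF 2[unfolded eq]]) simp
  finally show ?thesis .
qed

end

end

subsection \<open>The energy argument\<close>

lemma powr_eq_root_power: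
  assumes "x > 0" "n > 0"
  shows "x powr (real m / real n) = root n x ^ m"
  using assms by (simp add: root_powr_inverse powr_powr flip: powr_realpow)

text \<open>Used with \<open>b\<close> the fourth root of the autocorrelation,
  \<open>\<beta>\<close> the fourth root of \<open>card A\<close> and \<open>q\<close> the eighth
  root of \<open>K\<close>; the sixth moment is then the energy. If both alternatives failed, the
  ranges below, between and above the cutoffs would contribute at most a quarter, less than half and
  less than a quarter of it.\<close>

lemma moment_dichotomy:
  fixes b :: "'b \<Rightarrow> real"
  assumes D: "finite D" and b: "\<And>s. s \<in> D \<Longrightarrow> b s > 0" and pos: "\<beta> > 0" "q > 0"
    and m4: "(\<Sum>s\<in>D. b s ^ 4) = \<beta> ^ 8" and m6: "(\<Sum>s\<in>D. b s ^ 6) = \<beta> ^ 10 / q ^ 4"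
  shows "(\<Sum>s\<in>D. b s ^ 8) \<ge> \<beta> ^ 12 / (4 * q ^ 6) \<or>
    (\<Sum>s | s \<in> D \<and> \<beta> / (2 * q\<^sup>2) \<le> b s \<and> b s < \<beta> / q. b s ^ 5) \<ge> \<beta> ^ 9 / (2 * q ^ 3)"
proof (rule ccontr)
  let ?Q = "{s \<in> D. \<beta> / (2 * q\<^sup>2) \<le> b s \<and> b s < \<beta> / q}"
  assume "\<not> ?thesis"
  then have neg: "(\<Sum>s\<in>D. b s ^ 8) < \<beta> ^ 12 / (4 * q ^ 6)" "(\<Sum>s\<in>?Q. b s ^ 5) < \<beta> ^ 9 / (2 * q ^ 3)"
    by auto
  \<comment> \<open>Each range trades powers of \<open>b\<close> against its cutoff: the fourth
    power below, the fifth in the middle, the eighth above.\<close>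
  have pointwise: "b s ^ 6 \<le> (\<beta> / (2 * q\<^sup>2))\<^sup>2 * b s ^ 4 + \<beta> / q * (if s \<in> ?Q then b s ^ 5 else 0) + (q / \<beta>)\<^sup>2 * b s ^ 8"
    if s: "s \<in> D" for s
  proof -
    have bs: "b s > 0" by (rule b[OF s])
    consider "b s < \<beta> / (2 * q\<^sup>2)" | "s \<in> ?Q" | "b s \<ge> \<beta> / q"
      using s by force
    then show ?thesis
    proof cases
      case 1
      then have "(b s)\<^sup>2 * b s ^ 4 \<le> (\<beta> / (2 * q\<^sup>2))\<^sup>2 * b s ^ 4"
        using bs by (intro mult_right_mono power_mono) auto
      moreover have "0 \<le> \<beta> / q * (if s \<in> ?Q then b s ^ 5 else 0)" "0 \<le> (q / \<beta>)\<^sup>2 * b s ^ 8"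
        using bs pos by auto
      moreover have "b s ^ 6 = (b s)\<^sup>2 * b s ^ 4"
        by (simp add: power_add[symmetric])
      ultimately show ?thesis by linarith
    next
      case 2
      then have "b s * b s ^ 5 \<le> \<beta> / q * (if s \<in> ?Q then b s ^ 5 else 0)"
        using bs mult_right_mono[of "b s" "\<beta> / q" "b s ^ 5"] by simp
      moreover have "0 \<le> (\<beta> / (2 * q\<^sup>2))\<^sup>2 * b s ^ 4" "0 \<le> (q / \<beta>)\<^sup>2 * b s ^ 8"
        using bs pos by auto
      moreover have "b s ^ 6 = b s * b s ^ 5"
        by (simp add: power_Suc[symmetric] del: power_Suc)
      ultimately show ?thesis by linarith
    next
      case 3
      then have "1 \<le> q / \<beta> * b s"
        using pos by (simp add: field_simps)
      then have "1 * b s ^ 6 \<le> (q / \<beta> * b s)\<^sup>2 * b s ^ 6"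
        using bs by (intro mult_right_mono one_le_power) auto
      moreover have "0 \<le> (\<beta> / (2 * q\<^sup>2))\<^sup>2 * b s ^ 4" "0 \<le> \<beta> / q * (if s \<in> ?Q then b s ^ 5 else 0)"
        using bs pos by auto
      moreover have "(q / \<beta> * b s)\<^sup>2 * b s ^ 6 = (q / \<beta>)\<^sup>2 * b s ^ 8"
        by (simp only: power_mult_distrib mult.assoc power_add[symmetric]) simp
      ultimately show ?thesis by linarith
    qed
  qed
  have "\<beta> ^ 10 / q ^ 4 \<le> (\<Sum>s\<in>D. (\<beta> / (2 * q\<^sup>2))\<^sup>2 * b s ^ 4
      + \<beta> / q * (if s \<in> ?Q then b s ^ 5 else 0) + (q / \<beta>)\<^sup>2 * b s ^ 8)"
    unfolding m6[symmetric] by (rule sum_mono[OF pointwise])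
  also have "\<dots> = (\<beta> / (2 * q\<^sup>2))\<^sup>2 * (\<Sum>s\<in>D. b s ^ 4)
      + \<beta> / q * (\<Sum>s\<in>D. if s \<in> ?Q then b s ^ 5 else 0) + (q / \<beta>)\<^sup>2 * (\<Sum>s\<in>D. b s ^ 8)"
    by (simp only: sum.distrib sum_distrib_left)
  also have "(\<Sum>s\<in>D. if s \<in> ?Q then b s ^ 5 else 0) = (\<Sum>s\<in>?Q. b s ^ 5)"
    using D by (intro sum.mono_neutral_cong_right) auto
  also have "\<beta> / q * (\<Sum>s\<in>?Q. b s ^ 5) < \<beta> / q * (\<beta> ^ 9 / (2 * q ^ 3))"
    using neg(2) pos by (intro mult_strict_left_mono) auto
  also have "(q / \<beta>)\<^sup>2 * (\<Sum>s\<in>D. b s ^ 8) < (q / \<beta>)\<^sup>2 * (\<beta> ^ 12 / (4 * q ^ 6))"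
    using neg(1) pos by (intro mult_strict_left_mono) auto
  also have "(\<beta> / (2 * q\<^sup>2))\<^sup>2 * (\<Sum>s\<in>D. b s ^ 4) + \<beta> / q * (\<beta> ^ 9 / (2 * q ^ 3))
      + (q / \<beta>)\<^sup>2 * (\<beta> ^ 12 / (4 * q ^ 6)) = \<beta> ^ 10 / q ^ 4"
    unfolding m4 using pos by (simp add: field_simps power2_eq_square eval_nat_numeral)
  finally show False by simp
qed

text \<open>The moment method uses exponents \<open>2 ^ r\<close> only; rounding the logarithm of
  \<open>card A\<close> up to such an exponent costs at most a factor 2.\<close>

lemma ex_power_two_between:
  assumes "l \<ge> (1::real)"
  shows "\<exists>r. l \<le> 2 ^ r \<and> 2 ^ r \<le> 2 * l"
proof -
  obtain n where n: "l < 2 ^ n"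
    using real_arch_pow[of 2 l] by auto
  define r where "r = (LEAST r. l \<le> 2 ^ r)"
  have r: "l \<le> 2 ^ r"
    unfolding r_def by (rule LeastI[of _ n]) (use n in simp)
  show ?thesis
  proof (cases r)
    case 0
    then show ?thesis
      using r assms by (intro exI[of _ 0]) auto
  next
    case (Suc r')
    then have "\<not> l \<le> 2 ^ r'"
      using not_less_Least[of r' "\<lambda>r. l \<le> 2 ^ r"] by (simp add: r_def)
    then show ?thesis
      using r Suc by (intro exI[of _ r]) auto
  qed
qed

section \<open>Choice of parameters and the contradiction\<close>

context comm_group
begin

lemma additive_dim_attained:
  assumes "finite B"
  shows "\<exists>L\<subseteq>B. dissociated G L \<and> card L = additive_dim G B"
proof -
  let ?M = "{L. L \<subseteq> B \<and> dissociated G L}"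
  have "finite (card ` ?M)"
    using assms by auto
  moreover have "{} \<in> ?M"
    by (simp add: dissociated_def)
  ultimately have "Max (card ` ?M) \<in> card ` ?M"
    by (intro Max_in) auto
  then show ?thesis
    by (auto simp: additive_dim_def)
qed

lemma large_low_dim_subset_if_energy:
  assumes A: "finite A" "A \<subseteq> carrier G" "card A \<ge> 2" and K: "0 < K"
    and energy: "energy_3_2 G A = real (card A) powr (5/2) / K powr (1/2)"
  shows "\<exists>B\<subseteq>A. real (card B) \<ge> 1 / 512 * real (card A) / K\<^sup>2 \<and>
    real (additive_dim G B) \<le> 4096 * K powr (3/4) * log 2 (real (card A))"
proof (rule ccontr)
  assume contra: "\<not> ?thesis"
  define \<alpha> where "\<alpha> = real (card A)"
  define l where "l = log 2 \<alpha>"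
  \<comment> \<open>Fourth and eighth roots turn the fractional exponents of the argument into
    integers.\<close>
  define \<beta> where "\<beta> = root 4 \<alpha>"
  define q where "q = root 8 K"
  define b where "b s = root 4 (real (autocorr G A s))" for s
  let ?D = "diff_set A"
  note A' = A(1,2)
  have \<alpha>: "\<alpha> \<ge> 2" using A by (simp add: \<alpha>_def)
  have \<beta>: "\<beta> > 0" "\<beta> ^ 4 = \<alpha>"
    using \<alpha> by (simp_all add: \<beta>_def)
  have q: "q > 0" "q ^ 8 = K"
    using K by (simp_all add: q_def)
  have b0: "b s \<ge> 0" "b s ^ 4 = real (autocorr G A s)" for s
    by (simp_all add: b_def)
  have b: "b s > 0" if "s \<in> ?D" for s
    using that by (simp add: b_def diff_set_def)
  have m4: "(\<Sum>s\<in>?D. b s ^ 4) = \<beta> ^ 8"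
  proof -
    have "(\<Sum>s\<in>?D. b s ^ 4) = \<alpha>\<^sup>2"
      using sum_autocorr[OF A'] by (simp add: b0 \<alpha>_def)
    then show ?thesis
      by (simp add: \<beta>(2)[symmetric] power_mult[symmetric])
  qed
  have m6: "(\<Sum>s\<in>?D. b s ^ 6) = \<beta> ^ 10 / q ^ 4"
  proof -
    have "(\<Sum>s\<in>?D. b s ^ 6) = energy_3_2 G A"
      unfolding energy_3_2_def diff_set_def
    proof (intro sum.cong refl)
      fix s assume "s \<in> {x \<in> carrier G. autocorr G A x \<noteq> 0}"
      then show "b s ^ 6 = real (autocorr G A s) powr (3/2)"
        using powr_eq_root_power[of "real (autocorr G A s)" 4 6] by (simp add: b_def)
    qed
    moreover have "\<alpha> powr (5/2) = \<beta> ^ 10"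
      using powr_eq_root_power[of \<alpha> 4 10] \<alpha> by (simp add: \<beta>_def)
    moreover have "K powr (1/2) = q ^ 4"
      using powr_eq_root_power[of K 8 4] K by (simp add: q_def)
    ultimately show ?thesis
      using energy by (simp add: \<alpha>_def)
  qed
  have K34: "K powr (3/4) = q ^ 6"
    using powr_eq_root_power[of K 8 6] K by (simp add: q_def)
  \<comment> \<open>Autocorrelations are at most \<open>card A\<close>, so the energy is at most
    \<open>card A powr (5/2)\<close>, which means \<open>K >= 1\<close>.\<close>
  have q1: "q \<ge> 1"
  proof -
    have "\<beta> ^ 10 / q ^ 4 \<le> (\<Sum>s\<in>?D. \<beta>\<^sup>2 * b s ^ 4)"
      unfolding m6[symmetric]
    proof (rule sum_mono)
      fix s assume "s \<in> ?D"
      then have "real (autocorr G A s) \<le> \<alpha>"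
        using autocorr_le_card[OF A'] by (simp add: diff_set_def \<alpha>_def)
      then have "b s \<le> \<beta>"
        by (simp add: b_def \<beta>_def)
      then have "(b s)\<^sup>2 * b s ^ 4 \<le> \<beta>\<^sup>2 * b s ^ 4"
        using b0 by (intro mult_right_mono power_mono) auto
      then show "b s ^ 6 \<le> \<beta>\<^sup>2 * b s ^ 4"
        by (simp add: power_add[symmetric])
    qed
    also have "\<dots> = \<beta> ^ 10"
      by (simp add: sum_distrib_left[symmetric] m4 power_add[symmetric])
    finally have "1 ^ 4 \<le> q ^ 4"
      using \<beta>(1) q(1) by (simp add: field_simps)
    then show ?thesis
      using q(1) by (subst (asm) power_mono_iff) auto
  qed
  have l: "l \<ge> 1"
    using \<alpha> by (simp add: l_def)
  define \<sigma> where "\<sigma> = \<alpha> / (512 * q ^ 16)"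
  \<comment> \<open>The least integer above the dimension bound: a dimension beyond the bound is at
    least \<open>k\<close>, and \<open>k\<close> itself exceeds the bound.\<close>
  define k where "k = nat \<lfloor>4096 * q ^ 6 * l\<rfloor> + 1"
  have k: "real k > 4096 * q ^ 6 * l"
  proof -
    have "0 \<le> 4096 * q ^ 6 * l"
      using q l by simp
    then show ?thesis
      unfolding k_def by linarith
  qed
  have rich: "\<exists>L\<subseteq>B. dissociated G L \<and> card L = k" if B: "B \<subseteq> A" "real (card B) \<ge> \<sigma>" for B
  proof -
    have "K\<^sup>2 = q ^ 16"
      by (simp add: q(2)[symmetric] power_mult[symmetric])
    then have "real (additive_dim G B) > 4096 * q ^ 6 * l"
      using contra B by (auto simp: \<sigma>_def \<alpha>_def K34 l_def not_le)
    then have "k \<le> additive_dim G B"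
      unfolding k_def using q l by (simp add: nat_less_iff floor_less_iff Suc_le_eq)
    moreover obtain L where L: "L \<subseteq> B" "dissociated G L" "card L = additive_dim G B"
      using additive_dim_attained[of B] B(1) A(1) finite_subset by blast
    ultimately obtain L' where "L' \<subseteq> L" "card L' = k"
      using obtain_subset_with_card_n by metis
    then show ?thesis
      using L dissociated_subset[OF L(2)] by blast
  qed
  obtain r where r: "l \<le> 2 ^ r" "2 ^ r \<le> 2 * l"
    using ex_power_two_between[OF l] by blast
  \<comment> \<open>Large enough for functions on \<open>A\<close> and on its differences;
    \<open>l <= 2 ^ r\<close> makes \<open>4 ^ 2 ^ r\<close> at least \<open>m\<close>.\<close>
  define m where "m = (card A)\<^sup>2"
  have m: "real m \<le> 4 ^ 2 ^ r"
  proof -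
    have "real m = (2 powr l)\<^sup>2"
      using \<alpha> by (simp add: m_def l_def \<alpha>_def)
    also have "\<dots> \<le> (2 powr (2 ^ r))\<^sup>2"
      using r(1) by (intro power_mono powr_mono) auto
    also have "2 powr (2 ^ r) = (2::real) ^ 2 ^ r"
      using powr_realpow[of 2 "2 ^ r"] by simp
    also have "((2::real) ^ 2 ^ r)\<^sup>2 = 4 ^ 2 ^ r"
      by (simp add: power_mult[symmetric] mult.commute[of _ 2]) (simp add: power_mult)
    finally show ?thesis .
  qed
  have q6: "q ^ 6 \<ge> 1"
    using q1 by (rule one_le_power)
  have k2: "2 * 2 ^ r \<le> k"
  proof -
    have "2 * 2 ^ r \<le> 4 * l" using r(2) by simp
    also have "\<dots> \<le> 4096 * q ^ 6 * l"
      using q6 l by (intro mult_right_mono) auto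
    also have "\<dots> < real k" by (rule k)
    finally have "real (2 * 2 ^ r) < real k" by simp
    then show ?thesis by linarith
  qed
  \<comment> \<open>The norm per element: \<open>128 * 2 ^ r / k\<close> is at most
    \<open>256 / (4096 * q ^ 6)\<close>, the square of this value.\<close>
  define \<kappa> where "\<kappa> = 1 / (4 * q ^ 3)"
  have \<kappa>: "\<kappa> > 0" using q by (simp add: \<kappa>_def)
  have sqrt_le: "sqrt (128 * 2 ^ r / real k) \<le> \<kappa>"
  proof -
    have kpos: "0 < 4096 * q ^ 6 * l"
      using q l by simp
    have "128 * 2 ^ r / real k \<le> 256 * l / (4096 * q ^ 6 * l)"
      using r(2) k kpos l by (intro frac_le) auto
    also have "\<dots> = \<kappa>\<^sup>2"
      using l by (simp add: \<kappa>_def power_divide power_mult_distrib power_mult[symmetric])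
    finally show ?thesis
      using \<kappa> by (intro real_le_lsqrt) auto
  qed
  have \<sigma>: "\<sigma> > 0"
    using \<alpha> q by (simp add: \<sigma>_def)
  have decomp: "\<exists>R\<subseteq>S. real (card R) \<le> \<sigma> \<and> conv_bound G m (S - R) (real (card S) * \<kappa>)" if S: "S \<subseteq> A" for S
  proof -
    have "finite S" "S \<subseteq> carrier G"
      using S A' finite_subset by auto
    then obtain R where R: "R \<subseteq> S" "real (card R) \<le> \<sigma>"
      "conv_bound G m (S - R) (real (card S) * sqrt (128 * 2 ^ r / real k))"
      using conv_bound_if_no_large_low_dim_subset[OF _ _ m k2, of S \<sigma>] rich S \<sigma>
      by (force simp: max_def)
    moreover have "conv_bound G m (S - R) (real (card S) * \<kappa>)"
      using R(3) sqrt_le by (rule conv_bound_mono[OF _ mult_left_mono]) simp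
    ultimately show ?thesis by blast
  qed
  \<comment> \<open>Slightly more than \<open>\<alpha> * \<kappa>\<close>, to make room for a
    remainder of size \<open>\<sigma>\<close>: 1/4 + 1/512 < 1/3, and \<open>q >= 1\<close>.\<close>
  define c where "c = \<alpha> / (3 * q ^ 3)"
  have c: "conv_bound G m A c" "c \<ge> 0"
  proof -
    show "c \<ge> 0" using \<alpha> q by (simp add: c_def)
    obtain R where R: "R \<subseteq> A" "real (card R) \<le> \<sigma>" "conv_bound G m (A - R) (\<alpha> * \<kappa>)"
      using decomp[of A] by (auto simp: \<alpha>_def)
    have "conv_bound G m ((A - R) \<union> R) (\<alpha> * \<kappa> + real (card R))"
      using R A' finite_subset[OF R(1)] by (intro conv_bound_Un conv_bound_card) auto
    moreover have "(A - R) \<union> R = A" using R by blast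
    moreover have "\<alpha> * \<kappa> + real (card R) \<le> c"
    proof -
      have "q ^ 3 \<le> q ^ 16"
        using q1 by (intro power_increasing) auto
      then have "\<sigma> \<le> \<alpha> / (512 * q ^ 3)"
        unfolding \<sigma>_def using \<alpha> q by (intro divide_left_mono) auto
      also have "\<alpha> * \<kappa> + \<alpha> / (512 * q ^ 3) \<le> c"
        using \<alpha> q by (simp add: \<kappa>_def c_def field_simps)
      finally show ?thesis
        using R(2) by linarith
    qed
    ultimately show "conv_bound G m A c"
      by (metis conv_bound_mono)
  qed
  have card_le: "card A \<le> m" "card ?D \<le> m"
    using card_diff_set_le[OF A'] by (simp_all add: m_def power2_eq_square)
  define Q where "Q = {s \<in> ?D. \<beta> / (2 * q\<^sup>2) \<le> b s \<and> b s < \<beta> / q}"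
  have disj: "(\<Sum>s\<in>?D. b s ^ 8) \<ge> \<beta> ^ 12 / (4 * q ^ 6) \<or> (\<Sum>s\<in>Q. b s ^ 5) \<ge> \<beta> ^ 9 / (2 * q ^ 3)"
    unfolding Q_def by (rule moment_dichotomy[OF finite_diff_set[OF A'] b \<beta>(1) q(1) m4 m6])
  have "\<not> (\<Sum>s\<in>?D. b s ^ 8) \<ge> \<beta> ^ 12 / (4 * q ^ 6)"
  proof -
    have "(\<Sum>s\<in>?D. b s ^ 8) = (\<Sum>s\<in>?D. (real (autocorr G A s))\<^sup>2)"
      by (simp add: b0(2)[symmetric] power_mult[symmetric])
    also have "\<dots> \<le> c\<^sup>2 * \<alpha>"
      unfolding \<alpha>_def by (rule sum_autocorr_power2_le[OF A' c(1) card_le(1)])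
    also have "\<dots> = \<beta> ^ 12 / (9 * q ^ 6)"
      by (simp add: c_def \<beta>(2)[symmetric] power_divide power_mult_distrib power_mult[symmetric] power_add[symmetric])
    also have "\<dots> < \<beta> ^ 12 / (4 * q ^ 6)"
      using \<beta>(1) q(1) by (simp add: field_simps)
    finally show ?thesis by simp
  qed
  moreover have "\<not> (\<Sum>s\<in>Q. b s ^ 5) \<ge> \<beta> ^ 9 / (2 * q ^ 3)"
  proof
    define E where "E = (\<Sum>s\<in>Q. b s ^ 5)"
    define f where "f s = (if s \<in> Q then b s else 0)" for s
    assume "\<beta> ^ 9 / (2 * q ^ 3) \<le> (\<Sum>s\<in>Q. b s ^ 5)"
    then have E: "\<beta> ^ 9 / (2 * q ^ 3) \<le> E" by (simp add: E_def)
    have Epos: "E > 0"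
      using \<beta>(1) q(1) by (intro less_le_trans[OF _ E]) simp
    have Q: "Q \<subseteq> ?D" "finite Q"
      using finite_diff_set[OF A'] by (auto simp: Q_def)
    have "\<forall>s. \<exists>R\<subseteq>slice A s. real (card R) \<le> \<sigma> \<and> conv_bound G m (slice A s - R) (real (card (slice A s)) * \<kappa>)"
      by (intro allI decomp slice_subset[OF A'])
    then obtain R where R: "\<And>s. R s \<subseteq> slice A s" "\<And>s. real (card (R s)) \<le> \<sigma>"
      "\<And>s. conv_bound G m (slice A s - R s) (real (card (slice A s)) * \<kappa>)"
      by metis
    have "(\<Sum>s\<in>Q. real (autocorr G A s) * f s)\<^sup>2
      \<le> \<alpha> * (\<kappa> * sqrt \<alpha> * (\<alpha> * (c * sqrt (\<Sum>s\<in>Q. f s ^ 4))) + \<sigma> * (\<Sum>s\<in>Q. f s)\<^sup>2)"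
      unfolding \<alpha>_def
    proof (rule sum_autocorr_mult_power2_le[OF A' _ card_le(1) _ c R _ Q(1)])
      show "card Q \<le> m"
        using card_mono[OF finite_diff_set[OF A'] Q(1)] card_le(2) by linarith
    qed (use A(3) \<kappa> b0 in \<open>auto simp: f_def\<close>)
    also have "(\<Sum>s\<in>Q. real (autocorr G A s) * f s) = E"
      unfolding E_def by (intro sum.cong refl) (simp add: f_def b0(2)[symmetric] power_Suc2[symmetric] del: power_Suc)
    also have "(\<Sum>s\<in>Q. f s) = (\<Sum>s\<in>Q. b s)"
      by (simp add: f_def)
    also have "(\<Sum>s\<in>Q. f s ^ 4) = (\<Sum>s\<in>Q. b s ^ 4)"
      by (simp add: f_def)
    finally have main: "E\<^sup>2 \<le> \<alpha> * (\<kappa> * sqrt \<alpha> * (\<alpha> * (c * sqrt (\<Sum>s\<in>Q. b s ^ 4))) + \<sigma> * (\<Sum>s\<in>Q. b s)\<^sup>2)" .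
    have "(\<Sum>s\<in>Q. b s ^ 4) \<le> \<alpha>\<^sup>2"
    proof -
      have "(\<Sum>s\<in>Q. b s ^ 4) \<le> (\<Sum>s\<in>?D. b s ^ 4)"
        using Q finite_diff_set[OF A'] b0 by (intro sum_mono2) auto
      then show ?thesis
        by (simp add: m4 \<beta>(2)[symmetric] power_mult[symmetric])
    qed
    then have sq: "sqrt (\<Sum>s\<in>Q. b s ^ 4) \<le> \<alpha>"
      using \<alpha> by (intro real_le_lsqrt) (auto intro: sum_nonneg simp: b0)
    \<comment> \<open>The lower cutoff of \<open>Q\<close> bounds \<open>b s\<close> by a multiple
      of its fifth power, which makes the remainder term comparable with
      \<open>E\<^sup>2\<close>.\<close>
    have "(\<Sum>s\<in>Q. b s) \<le> (\<Sum>s\<in>Q. (2 * q\<^sup>2 / \<beta>) ^ 4 * b s ^ 5)"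
    proof (rule sum_mono)
      fix s assume "s \<in> Q"
      then have "1 \<le> 2 * q\<^sup>2 / \<beta> * b s"
        using \<beta>(1) q(1) by (simp add: Q_def field_simps)
      then have "1 * b s \<le> (2 * q\<^sup>2 / \<beta> * b s) ^ 4 * b s"
        using b0 by (intro mult_right_mono one_le_power) auto
      moreover have "b s ^ 5 = b s ^ 4 * b s"
        by (simp add: eval_nat_numeral)
      ultimately show "b s \<le> (2 * q\<^sup>2 / \<beta>) ^ 4 * b s ^ 5"
        by (simp only: power_mult_distrib mult.assoc mult_1)
    qed
    then have "(\<Sum>s\<in>Q. b s) \<le> (2 * q\<^sup>2 / \<beta>) ^ 4 * E"
      by (simp add: E_def sum_distrib_left)
    then have "\<sigma> * (\<Sum>s\<in>Q. b s)\<^sup>2 \<le> \<sigma> * ((2 * q\<^sup>2 / \<beta>) ^ 4 * E)\<^sup>2"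
      using \<sigma> b0 by (intro mult_left_mono power_mono sum_nonneg) auto
    \<comment> \<open>The squared factor is \<open>256 * K\<^sup>2 / \<alpha>\<^sup>2\<close>; the
      512 in \<open>\<sigma>\<close> is chosen so that, after multiplication by
      \<open>\<alpha>\<close>, exactly half of \<open>E\<^sup>2\<close> remains.\<close>
    also have "\<dots> = E\<^sup>2 / (2 * \<alpha>)"
    proof -
      have "(2 * q\<^sup>2 / \<beta>) ^ 4 = 16 * q ^ 8 / \<alpha>" "q ^ 16 = (q ^ 8)\<^sup>2"
        by (simp_all add: \<beta>(2)[symmetric] power_divide power_mult_distrib power_mult[symmetric])
      moreover have "q ^ 8 > 0"
        using q(1) by simp
      ultimately show ?thesis
        using \<alpha> by (simp add: \<sigma>_def field_simps power2_eq_square)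
    qed
    finally have rem: "\<sigma> * (\<Sum>s\<in>Q. b s)\<^sup>2 \<le> E\<^sup>2 / (2 * \<alpha>)" .
    have sqrt_\<alpha>: "sqrt \<alpha> = \<beta>\<^sup>2"
      using \<beta> by (intro real_sqrt_unique) (simp_all add: power_mult[symmetric])
    have "\<kappa> * sqrt \<alpha> * (\<alpha> * (c * sqrt (\<Sum>s\<in>Q. b s ^ 4))) \<le> \<kappa> * sqrt \<alpha> * (\<alpha> * (c * \<alpha>))"
      using sq \<kappa> \<alpha> c(2) by (intro mult_left_mono) auto
    also have "\<dots> = \<beta> ^ 14 / (12 * q ^ 6)"
      unfolding \<kappa>_def c_def sqrt_\<alpha> unfolding \<beta>(2)[symmetric]
      by (simp add: field_simps power_add[symmetric])
    \<comment> \<open>The remainder takes half of \<open>E\<^sup>2\<close>. The main term has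
      constant 1/12 from \<open>\<kappa>\<close> and \<open>c\<close>, doubled to 1/6, which is
      below the 1/4 that the lower bound on \<open>E\<close> demands.\<close>
    finally have "E\<^sup>2 \<le> \<alpha> * (\<beta> ^ 14 / (12 * q ^ 6) + E\<^sup>2 / (2 * \<alpha>))"
      using main rem \<alpha> by (smt (verit) mult_left_mono)
    also have "\<dots> = \<beta> ^ 18 / (12 * q ^ 6) + E\<^sup>2 / 2"
      using \<alpha> \<beta>(1) by (simp add: distrib_left \<beta>(2)[symmetric] power_add[symmetric])
    finally have "E\<^sup>2 \<le> \<beta> ^ 18 / (6 * q ^ 6)"
      by simp
    also have "\<dots> < \<beta> ^ 18 / (4 * q ^ 6)"
      using \<beta>(1) q(1) by (simp add: field_simps)
    also have "\<dots> = (\<beta> ^ 9 / (2 * q ^ 3))\<^sup>2"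
      by (simp add: power_divide power_mult_distrib power_mult[symmetric])
    also have "\<dots> \<le> E\<^sup>2"
      using E \<beta>(1) q(1) by (intro power_mono) auto
    finally show False by simp
  qed
  ultimately show False
    using disj by blast
qed

end

subsection \<open>Transfer along injective homomorphisms\<close>

locale injective_hom = N: comm_group N + H: comm_group H
  for N :: "('b, 'n) monoid_scheme" and H :: "('a, 'm) monoid_scheme" +
  fixes \<psi> :: "'b \<Rightarrow> 'a"
  assumes hom: "\<psi> \<in> hom N H" and inj: "inj_on \<psi> (carrier N)"
begin

sublocale group_hom N H \<psi>
  by unfold_locales (rule hom)

lemma hom_finprod:
  assumes "finite I" "\<And>i. i \<in> I \<Longrightarrow> f i \<in> carrier N"
  shows "\<psi> (\<Otimes>\<^bsub>N\<^esub>i\<in>I. f i) = (\<Otimes>\<^bsub>H\<^esub>i\<in>I. \<psi> (f i))"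
  using assms
proof (induction I rule: finite_induct)
  case (insert i I)
  then have "f i \<in> carrier N" "f \<in> I \<rightarrow> carrier N" "(\<lambda>i. \<psi> (f i)) \<in> I \<rightarrow> carrier H"
    by auto
  with insert show ?case
    by simp
qed simp

lemma inj_subset: "B \<subseteq> carrier N \<Longrightarrow> inj_on \<psi> B"
  using inj inj_on_subset by blast

text \<open>Sign patterns on \<open>L\<close> and on its image correspond through
  \<open>\<psi>\<close>, and by injectivity the image of a product is trivial only if the product
  is.\<close>

lemma dissociated_image_iff:
  assumes L: "L \<subseteq> carrier N"
  shows "dissociated H (\<psi> ` L) \<longleftrightarrow> dissociated N L"
proof (cases "finite L")
  case True
  have prod: "(\<Otimes>\<^bsub>H\<^esub>y\<in>\<psi> ` L. y [^]\<^bsub>H\<^esub> \<epsilon> y) = \<psi> (\<Otimes>\<^bsub>N\<^esub>x\<in>L. x [^]\<^bsub>N\<^esub> \<epsilon> (\<psi> x))" for \<epsilon> :: "'a \<Rightarrow> int"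
  proof -
    have "(\<Otimes>\<^bsub>H\<^esub>y\<in>\<psi> ` L. y [^]\<^bsub>H\<^esub> \<epsilon> y) = (\<Otimes>\<^bsub>H\<^esub>x\<in>L. \<psi> x [^]\<^bsub>H\<^esub> \<epsilon> (\<psi> x))"
      using L by (intro H.finprod_reindex inj_subset) auto
    also have "\<dots> = (\<Otimes>\<^bsub>H\<^esub>x\<in>L. \<psi> (x [^]\<^bsub>N\<^esub> \<epsilon> (\<psi> x)))"
      using L by (intro H.finprod_cong') (auto simp: hom_int_pow subsetD)
    also have "\<dots> = \<psi> (\<Otimes>\<^bsub>N\<^esub>x\<in>L. x [^]\<^bsub>N\<^esub> \<epsilon> (\<psi> x))"
      using True L by (intro hom_finprod[symmetric]) auto
    finally show ?thesis .
  qed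
  have one: "\<psi> (\<Otimes>\<^bsub>N\<^esub>x\<in>L. x [^]\<^bsub>N\<^esub> \<delta> x) = \<one>\<^bsub>H\<^esub> \<longleftrightarrow> (\<Otimes>\<^bsub>N\<^esub>x\<in>L. x [^]\<^bsub>N\<^esub> \<delta> x) = \<one>\<^bsub>N\<^esub>" for \<delta> :: "'b \<Rightarrow> int"
  proof -
    have "(\<Otimes>\<^bsub>N\<^esub>x\<in>L. x [^]\<^bsub>N\<^esub> \<delta> x) \<in> carrier N"
      using L by (intro N.finprod_closed) auto
    then show ?thesis
      using inj_onD[OF inj, of _ "\<one>\<^bsub>N\<^esub>"] by auto
  qed
  show ?thesis
  proof
    assume H: "dissociated H (\<psi> ` L)"
    show "dissociated N L"
      unfolding dissociated_def
    proof (intro conjI allI impI True L)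
      fix \<delta> :: "'b \<Rightarrow> int"
      assume \<delta>: "(\<forall>x\<in>L. \<delta> x \<in> {-1, 0, 1}) \<and> (\<Otimes>\<^bsub>N\<^esub>x\<in>L. x [^]\<^bsub>N\<^esub> \<delta> x) = \<one>\<^bsub>N\<^esub>"
      define \<epsilon> where "\<epsilon> y = \<delta> (inv_into L \<psi> y)" for y
      have \<epsilon>: "\<epsilon> (\<psi> x) = \<delta> x" if "x \<in> L" for x
        using that inj_subset[OF L] by (simp add: \<epsilon>_def)
      have "(\<Otimes>\<^bsub>N\<^esub>x\<in>L. x [^]\<^bsub>N\<^esub> \<epsilon> (\<psi> x)) = (\<Otimes>\<^bsub>N\<^esub>x\<in>L. x [^]\<^bsub>N\<^esub> \<delta> x)"
        using L \<epsilon> by (intro N.finprod_cong') auto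
      then have "(\<Otimes>\<^bsub>H\<^esub>y\<in>\<psi> ` L. y [^]\<^bsub>H\<^esub> \<epsilon> y) = \<one>\<^bsub>H\<^esub>"
        using \<delta> by (simp only: prod hom_one)
      moreover have "\<forall>y\<in>\<psi> ` L. \<epsilon> y \<in> {-1, 0, 1}"
        using \<delta> \<epsilon> by auto
      ultimately have "\<forall>y\<in>\<psi> ` L. \<epsilon> y = 0"
        using H unfolding dissociated_def by blast
      then show "\<forall>x\<in>L. \<delta> x = 0"
        using \<epsilon> by auto
    qed
  next
    assume N: "dissociated N L"
    show "dissociated H (\<psi> ` L)"
      unfolding dissociated_def
    proof (intro conjI allI impI)
      show "finite (\<psi> ` L)" "\<psi> ` L \<subseteq> carrier H"
        using True L by auto
      fix \<epsilon> :: "'a \<Rightarrow> int"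
      assume \<epsilon>: "(\<forall>y\<in>\<psi> ` L. \<epsilon> y \<in> {-1, 0, 1}) \<and> (\<Otimes>\<^bsub>H\<^esub>y\<in>\<psi> ` L. y [^]\<^bsub>H\<^esub> \<epsilon> y) = \<one>\<^bsub>H\<^esub>"
      then have "(\<Otimes>\<^bsub>N\<^esub>x\<in>L. x [^]\<^bsub>N\<^esub> \<epsilon> (\<psi> x)) = \<one>\<^bsub>N\<^esub>"
        by (simp only: prod one)
      moreover have "\<forall>x\<in>L. \<epsilon> (\<psi> x) \<in> {-1, 0, 1}"
        using \<epsilon> by auto
      ultimately have "\<forall>x\<in>L. \<epsilon> (\<psi> x) = 0"
        using N[unfolded dissociated_def, THEN conjunct2, THEN conjunct2, THEN spec, of "\<lambda>x. \<epsilon> (\<psi> x)"] by blast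
      then show "\<forall>y\<in>\<psi> ` L. \<epsilon> y = 0"
        by auto
    qed
  qed
next
  case False
  \<comment> \<open>By injectivity \<open>L\<close> and its image are infinite together, and
    dissociated sets are finite; so both sides are false.\<close>
  then show ?thesis
    using finite_imageD[OF _ inj_subset[OF L]] by (auto simp: dissociated_def)
qed

lemma additive_dim_image:
  assumes B: "B \<subseteq> carrier N"
  shows "additive_dim H (\<psi> ` B) = additive_dim N B"
proof -
  have "{L. L \<subseteq> \<psi> ` B \<and> dissociated H L} = (`) \<psi> ` {L. L \<subseteq> B \<and> dissociated N L}"
    using B dissociated_image_iff by (auto simp: subset_image_iff image_iff)
  moreover have "card (\<psi> ` L) = card L" if "L \<subseteq> B" for L
    using that B by (intro card_image inj_subset) auto
  ultimately have "card ` {L. L \<subseteq> \<psi> ` B \<and> dissociated H L} = card ` {L. L \<subseteq> B \<and> dissociated N L}"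
    by (force simp: image_image)
  then show ?thesis
    by (simp add: additive_dim_def)
qed

lemma autocorr_image:
  assumes A: "A \<subseteq> carrier N" and x: "x \<in> carrier N"
  shows "autocorr H (\<psi> ` A) (\<psi> x) = autocorr N A x"
proof -
  let ?P = "{(a, a'). a \<in> A \<and> a' \<in> A \<and> a' \<otimes>\<^bsub>N\<^esub> inv\<^bsub>N\<^esub> a = x}"
  have diff: "\<psi> a' \<otimes>\<^bsub>H\<^esub> inv\<^bsub>H\<^esub> \<psi> a = \<psi> x \<longleftrightarrow> a' \<otimes>\<^bsub>N\<^esub> inv\<^bsub>N\<^esub> a = x" if "a \<in> A" "a' \<in> A" for a a'
  proof -
    have "a \<in> carrier N" "a' \<in> carrier N" using that A by auto
    then have "\<psi> a' \<otimes>\<^bsub>H\<^esub> inv\<^bsub>H\<^esub> \<psi> a = \<psi> (a' \<otimes>\<^bsub>N\<^esub> inv\<^bsub>N\<^esub> a)" "a' \<otimes>\<^bsub>N\<^esub> inv\<^bsub>N\<^esub> a \<in> carrier N"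
      by simp_all
    then show ?thesis
      using inj_on_eq_iff[OF inj _ x] by simp
  qed
  have "{(b, b'). b \<in> \<psi> ` A \<and> b' \<in> \<psi> ` A \<and> b' \<otimes>\<^bsub>H\<^esub> inv\<^bsub>H\<^esub> b = \<psi> x} = map_prod \<psi> \<psi> ` ?P"
    using diff by (force simp: image_iff)
  moreover have "inj_on (map_prod \<psi> \<psi>) ?P"
    by (rule inj_on_subset[OF map_prod_inj_on[OF inj inj]]) (use A in auto)
  ultimately show ?thesis
    by (simp add: autocorr_def card_image)
qed

lemma energy_3_2_image:
  assumes A: "A \<subseteq> carrier N"
  shows "energy_3_2 H (\<psi> ` A) = energy_3_2 N A"
proof -
  \<comment> \<open>Differences of images are images, so elements outside the range of
    \<open>\<psi>\<close> do not enter the energy.\<close>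
  have "y \<in> \<psi> ` carrier N" if "autocorr H (\<psi> ` A) y \<noteq> 0" for y
  proof -
    have "{(b, b'). b \<in> \<psi> ` A \<and> b' \<in> \<psi> ` A \<and> b' \<otimes>\<^bsub>H\<^esub> inv\<^bsub>H\<^esub> b = y} \<noteq> {}"
      using that unfolding autocorr_def by (metis card.empty)
    then obtain a a' where "a \<in> A" "a' \<in> A" "y = \<psi> a' \<otimes>\<^bsub>H\<^esub> inv\<^bsub>H\<^esub> \<psi> a"
      by auto
    moreover from this(1,2) have "a \<in> carrier N" "a' \<in> carrier N"
      using A by auto
    ultimately have "y = \<psi> (a' \<otimes>\<^bsub>N\<^esub> inv\<^bsub>N\<^esub> a)" "a' \<otimes>\<^bsub>N\<^esub> inv\<^bsub>N\<^esub> a \<in> carrier N"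
      by simp_all
    then show ?thesis
      by blast
  qed
  note supp = this
  have "{y \<in> carrier H. autocorr H (\<psi> ` A) y \<noteq> 0} = \<psi> ` {x \<in> carrier N. autocorr N A x \<noteq> 0}"
  proof (intro equalityI subsetI)
    fix y assume "y \<in> {y \<in> carrier H. autocorr H (\<psi> ` A) y \<noteq> 0}"
    then have y: "autocorr H (\<psi> ` A) y \<noteq> 0" by simp
    then obtain x where x: "x \<in> carrier N" "y = \<psi> x" using supp by blast
    with y show "y \<in> \<psi> ` {x \<in> carrier N. autocorr N A x \<noteq> 0}"
      by (simp add: autocorr_image[OF A])
  next
    fix y assume "y \<in> \<psi> ` {x \<in> carrier N. autocorr N A x \<noteq> 0}"
    then obtain x where "x \<in> carrier N" "autocorr N A x \<noteq> 0" "y = \<psi> x" by blast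
    then show "y \<in> {y \<in> carrier H. autocorr H (\<psi> ` A) y \<noteq> 0}"
      by (simp add: autocorr_image[OF A])
  qed
  then show ?thesis
    unfolding energy_3_2_def
    by (simp add: sum.reindex inj_subset) (simp add: autocorr_image[OF A])
qed

text \<open>Pull \<open>A\<close> back to \<open>N\<close> and push the set \<open>B\<close> found
  there forward; cardinality, energy and dimension are preserved.\<close>

lemma large_low_dim_subsets_image:
  assumes N: "large_low_dim_subsets c C N"
    and A: "finite A" "A \<subseteq> \<psi> ` carrier N" "card A \<ge> 2" and K: "0 < K"
    and energy: "energy_3_2 H A = real (card A) powr (5/2) / K powr (1/2)"
  shows "\<exists>B\<subseteq>A. real (card B) \<ge> c * real (card A) / K\<^sup>2 \<and>
    real (additive_dim H B) \<le> C * K powr (3/4) * log 2 (real (card A))"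
proof -
  obtain A' where A': "A' \<subseteq> carrier N" "A = \<psi> ` A'"
    using A(2) by (auto simp: subset_image_iff)
  have inj': "inj_on \<psi> A'" by (rule inj_subset[OF A'(1)])
  then have card: "card A = card A'" "finite A'"
    using A A' by (auto simp: card_image finite_image_iff)
  have "energy_3_2 N A' = real (card A') powr (5/2) / K powr (1/2)"
    using energy card energy_3_2_image[OF A'(1)] A'(2) by simp
  then obtain B where B: "B \<subseteq> A'" "real (card B) \<ge> c * real (card A') / K\<^sup>2"
    "real (additive_dim N B) \<le> C * K powr (3/4) * log 2 (real (card A'))"
    using N[unfolded large_low_dim_subsets_def, rule_format, of A' K] A' card A(3) K by auto
  have BN: "B \<subseteq> carrier N" using B A' by blast
  show ?thesis
  proof (intro exI conjI)
    show "\<psi> ` B \<subseteq> A" using B A' by blast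
    show "real (card (\<psi> ` B)) \<ge> c * real (card A) / K\<^sup>2"
      using B(2) card by (simp add: card_image inj_subset[OF BN])
    show "real (additive_dim H (\<psi> ` B)) \<le> C * K powr (3/4) * log 2 (real (card A))"
      using B(3) card by (simp add: additive_dim_image[OF BN])
  qed
qed

end

section \<open>Countable groups realised on the natural numbers\<close>

text \<open>Elements of the generated subgroup are products of finite words in the generators and
  their inverses, and a countable alphabet has countably many words.\<close>

lemma (in group) countable_generate:
  assumes "countable A" "A \<subseteq> carrier G"
  shows "countable (generate G A)"
proof -
  let ?B = "A \<union> m_inv G ` A"
  define w where "w xs = foldr (\<otimes>) xs \<one>" for xs
  have B: "?B \<subseteq> carrier G"
    using assms by auto
  have closed: "w xs \<in> carrier G" if "xs \<in> lists ?B" for xs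
    using that by induction (use B in \<open>auto simp: w_def\<close>)
  have append: "w (xs @ ys) = w xs \<otimes> w ys" if "xs \<in> lists ?B" "ys \<in> lists ?B" for xs ys
    using that(1)
  proof induction
    case Nil
    then show ?case using closed[OF that(2)] by (simp add: w_def)
  next
    case (Cons x xs)
    then have "x \<in> carrier G" using B by auto
    then show ?case
      using Cons closed[OF Cons(2)] closed[OF that(2)] by (simp add: w_def m_assoc)
  qed
  have "generate G A \<subseteq> w ` lists ?B"
  proof
    fix x assume "x \<in> generate G A"
    then show "x \<in> w ` lists ?B"
    proof induction
      case one
      then show ?case by (intro image_eqI[of _ _ "[]"]) (auto simp: w_def)
    next
      case (incl a)
      then show ?case using assms by (intro image_eqI[of _ _ "[a]"]) (auto simp: w_def)
    next
      case (inv a)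
      then show ?case using assms by (intro image_eqI[of _ _ "[inv a]"]) (auto simp: w_def)
    next
      case (eng a b)
      then obtain xs ys where "xs \<in> lists ?B" "a = w xs" "ys \<in> lists ?B" "b = w ys"
        by auto
      then show ?case
        by (intro image_eqI[of _ _ "xs @ ys"]) (auto simp: append)
    qed
  qed
  moreover have "countable (w ` lists ?B)"
    using assms by (intro countable_image countable_lists) auto
  ultimately show ?thesis
    by (rule countable_subset)
qed

text \<open>An injective enumeration \<open>h\<close> of the countable subgroup generated by
  \<open>A\<close> transports its multiplication to natural numbers; the inverse of \<open>h\<close>
  is the embedding \<open>\<psi>\<close>.\<close>

lemma (in comm_group) ex_nat_injective_hom:
  assumes A: "countable A" "A \<subseteq> carrier G"
  shows "\<exists>(N :: nat monoid) \<psi>. injective_hom N G \<psi> \<and> A \<subseteq> \<psi> ` carrier N"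
proof -
  define S where "S = generate G A"
  interpret S: subgroup S G
    unfolding S_def by (rule generate_is_subgroup[OF A(2)])
  define h where "h = to_nat_on S"
  have h: "inj_on h S"
    unfolding h_def S_def by (intro inj_on_to_nat_on countable_generate A)
  define \<psi> where "\<psi> = inv_into S h"
  have \<psi>h: "\<psi> (h s) = s" if "s \<in> S" for s
    using h that by (simp add: \<psi>_def)
  define N where "N = \<lparr>carrier = h ` S, monoid.mult = (\<lambda>x y. h (\<psi> x \<otimes> \<psi> y)), one = h \<one>\<rparr>"
  have S: "s \<in> carrier G" if "s \<in> S" for s
    using that S.subset by auto
  have N: "carrier N = h ` S" "\<one>\<^bsub>N\<^esub> = h \<one>" "x \<otimes>\<^bsub>N\<^esub> y = h (\<psi> x \<otimes> \<psi> y)" for x y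
    by (simp_all add: N_def)
  have "comm_group N"
  proof (rule comm_groupI)
    fix x assume "x \<in> carrier N"
    then obtain s where s: "s \<in> S" "x = h s" by (auto simp: N)
    show "\<exists>y\<in>carrier N. y \<otimes>\<^bsub>N\<^esub> x = \<one>\<^bsub>N\<^esub>"
      using s S by (intro bexI[of _ "h (inv s)"]) (auto simp: N \<psi>h)
  qed (auto simp: N \<psi>h S m_ac)
  moreover have "\<psi> \<in> hom N G"
    by (auto simp: hom_def N \<psi>h S)
  moreover have "inj_on \<psi> (carrier N)"
    by (auto simp: inj_on_def N \<psi>h)
  ultimately have "injective_hom N G \<psi>"
    by (simp add: injective_hom_def injective_hom_axioms_def comm_group_axioms)
  moreover have "A \<subseteq> \<psi> ` carrier N"
  proof
    fix a assume "a \<in> A"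
    then have "a \<in> S" by (auto simp: S_def intro: generate.incl)
    then show "a \<in> \<psi> ` carrier N"
      by (auto simp: N image_image \<psi>h intro!: image_eqI[of _ _ a])
  qed
  ultimately show ?thesis by blast
qed

theorem theorem23:
  "(\<exists>c>0. \<exists>C>0. \<forall>G :: nat monoid. comm_group G \<longrightarrow> large_low_dim_subsets c C G) \<and>
   (\<forall>c>0. \<forall>C>0.
      (\<forall>G :: nat monoid. comm_group G \<longrightarrow> large_low_dim_subsets c C G) \<longrightarrow>
      (\<forall>H :: 'a monoid. comm_group H \<longrightarrow> large_low_dim_subsets c C H))"
proof (intro conjI allI impI)
  have "large_low_dim_subsets (1 / 512) 4096 G" if "comm_group G" for G :: "nat monoid"
    using comm_group.large_low_dim_subset_if_energy[OF that]
    unfolding large_low_dim_subsets_def by blast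
  then show "\<exists>c>0. \<exists>C>0. \<forall>G :: nat monoid. comm_group G \<longrightarrow> large_low_dim_subsets c C G"
    by (intro exI[of _ "1 / 512 :: real"] exI[of _ "4096 :: real"] conjI) auto
next
  fix c C :: real and H :: "'a monoid"
  assume nat: "\<forall>G :: nat monoid. comm_group G \<longrightarrow> large_low_dim_subsets c C G" and "comm_group H"
  interpret H: comm_group H by fact
  show "large_low_dim_subsets c C H"
    unfolding large_low_dim_subsets_def
  proof (intro allI impI, elim conjE)
    fix A K
    assume A: "finite A" "A \<subseteq> carrier H" "2 \<le> card A" and K: "0 < K"
      and energy: "energy_3_2 H A = real (card A) powr (5/2) / K powr (1/2)"
    \<comment> \<open>As \<open>A\<close> is finite, it lies in the image of a group on the natural
      numbers, where the given constants apply.\<close>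
    obtain N :: "nat monoid" and \<psi> where inj: "injective_hom N H \<psi>" and sub: "A \<subseteq> \<psi> ` carrier N"
      using H.ex_nat_injective_hom[OF countable_finite[OF A(1)] A(2)] by blast
    interpret injective_hom N H \<psi> by (rule inj)
    have "large_low_dim_subsets c C N"
      using nat N.comm_group_axioms by blast
    then show "\<exists>B\<subseteq>A. real (card B) \<ge> c * real (card A) / K\<^sup>2 \<and>
        real (additive_dim H B) \<le> C * K powr (3/4) * log 2 (real (card A))"
      by (rule large_low_dim_subsets_image[OF _ A(1) sub A(3) K energy])
  qed
qed

end
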